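(* For $i\in\{1,2\}$ let $U_i\subseteq\mathbb{R}^{n_i}$ be non-empty and open, let $J_i,R_i\in\mathcal{C}^\infty(U_i,\mathbb{R}^{n_i\times n_i})$ with $J_i(\cdot)=-J_i(\cdot)^\top$ and $R_i(\cdot)=R_i(\cdot)^\top\geq 0$ pointwise, let $B_i\in\mathcal{C}^\infty(U_i,\mathbb{R}^{n_i\times m_i})$ and $H_i\in\mathcal{C}^\infty(U_i)$. Consider the port-Hamiltonian systems $$\tfrac{\mathrm{d}}{\mathrm{d}t}x_i=\big(J_i(x_i)-R_i(x_i)\big)\nabla H_i(x_i)+B_i(x_i)u_i,\qquad y_i=B_i(x_i)^\top\nabla H_i(x_i),$$ with their canonical geometric representations $(\mathcal{D}_i,\mathcal{R}_i,H_i)$, and the interconnection constraint $$u_1=A(x_1,x_2)y_2,\qquad u_2=-A(x_1,x_2)^\top y_1$$ with $A\in\mathcal{C}^\infty(\mathbb{R}^{n_1+n_2},\mathbb{R}^{m_1\times m_2})$, represented by the Dirac structure $\mathcal{D}_{\mathrm{int}}$. Then, for $\mathfrak{t}\in\{\mathrm{c},\mathrm{w}\}$ and all real $t_0<t_1$, $$\big(\mathfrak{B}^{\mathfrak{t}}_{\mathcal{D}_1,\mathcal{R}_1,H_1}\Vert_{\mathcal{D}_{\mathrm{int}}}\mathfrak{B}^{\mathfrak{t}}_{\mathcal{D}_2,\mathcal{R}_2,H_2}\big)([t_0,t_1])=\mathfrak{B}^{\mathfrak{t}}_{\mathcal{D}_1\Vert_{\mathcal{D}_{\mathrm{int}}}\mathcal{D}_2,\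 \mathcal{R}_1\times\mathcal{R}_2,\ H_1+H_2}([t_0,t_1]).$$
   Context: \textbf{Geometry.} $(\mathbb{R}^N)^*$ is identified with $\mathbb{R}^N$. On $\mathbb{R}^N\oplus\mathbb{R}^N$ consider $\langle\langle (f,e),(f',e')\rangle\rangle=\langle e',f\rangle+\langle e,f'\rangle$ and $\Omega((f,e),(f',e'))=\langle e',f\rangle-\langle e,f'\rangle$. For $U$ open in a Euclidean space, a Dirac structure (Lagrangian subbundle) in $U\times(\mathbb{R}^N\oplus\mathbb{R}^N)$ is a smooth subvector bundle of rank $N$ whose fibres are isotropic for $\langle\langle\cdot,\cdot\rangle\rangle$ (respectively $\Omega$). \textbf{Canonical representation.} For $i\in\{1,2\}$ and $x\in U_i$, $$(\mathcal{D}_i)_x=\big\{\big(J_i(x)\alpha+e+B_i(x)u,\,-\alpha,\,-B_i(x)^\top\alpha,\,\alpha,\,e,\,u\big)\,\big|\,\alpha,e\in\mathbb{R}^{n_i},u\in\mathbb{R}^{m_i}\big\},\quad(\mathcal{R}_i)_x=\{(f,R_i(x)f)\mid f\in\mathbb{R}^{n_i}\}.$$ The interconnection constraint is represented, over $U_1\times U_2$, by $$(\mathcal{D}_{\mathrm{int}})_{(x_1,x_2)}=\{(\zeta_1,\zeta_2,-A(x_1,x_2)\zeta_2,A(x_1,x_2)^\top\zeta_1)\mid\zeta_i\in\mathbb{R}^{m_i}\},$$ where $\zeta_i=-y_i$. $\mathcal{R}_1\times\mathcal{R}_2$ is the bundle over $U_1\times U_2$ of all $(f_1,f_2,e_1,e_2)$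 with $(f_i,e_i)\in(\mathcal{R}_i)_{x_i}$. The fibre of $\mathcal{D}_1\Vert_{\mathcal{D}_{\mathrm{int}}}\mathcal{D}_2$ over $(x_1,x_2)$ is the set of all $(v_1,v_2,f_1,f_2,\alpha_1,\alpha_2,e_1,e_2)$ for which there is $(\zeta_1,\zeta_2,w_1,w_2)\in(\mathcal{D}_{\mathrm{int}})_{(x_1,x_2)}$ with $(v_i,f_i,\zeta_i,\alpha_i,e_i,w_i)\in(\mathcal{D}_i)_{x_i}$, $i=1,2$; explicitly it consists of all $$\big(J_1\alpha_1+e_1+B_1AB_2^\top\alpha_2,\ J_2\alpha_2+e_2-B_2A^\top B_1^\top\alpha_1,\ -\alpha_1,-\alpha_2,\ \alpha_1,\alpha_2,\ e_1,e_2\big)$$ (matrices evaluated at $x_1,x_2$), a smooth Dirac structure. \textbf{Function spaces.} Let $I=[t_0,t_1]$. $\mathcal{C}^1(I,U)$ is the set of continuous curves $I\to U$ that extend to a $\mathcal{C}^1$ curve on an open interval containing $I$. $(\mathcal{C}\cap W^{1,1})(I,U)$ is the set of continuous $x:I\to U$ having a weak derivative $\tfrac{\mathrm{d}}{\mathrm{d}t}x\in\mathcal{L}^1(I,\mathbb{R}^n)$. \textbf{Weak sense.} Let $x:I\to U$ be continuous and $(f,e)\in\mathcal{L}^1(I,\mathbb{R}^N\oplus\mathbb{R}^N)$. For a Dirac structure $\mathcal{D}$, $(f,e)\in\mathcal{D}_x$ in the weak sense means $\int_I\langle\varepsilon(t),f(t)\rangle+\langle e(t),\varphi(t)\rangle\,\mathrm{d}t=0$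 for all continuous $(\varphi,\varepsilon):I\to\mathbb{R}^N\oplus\mathbb{R}^N$ with compact support in $(t_0,t_1)$ and $(\varphi(t),\varepsilon(t))\in\mathcal{D}_{x(t)}$ for all $t$. For a Lagrangian subbundle, the same with $+$ replaced by $-$. \textbf{Behaviours.} For $U\subseteq\mathbb{R}^n$ open, a Dirac structure $\mathcal{D}\le U\times(\mathbb{R}^{n+m_r+m_p}\oplus\mathbb{R}^{n+m_r+m_p})$, a Lagrangian subbundle $\mathcal{R}\le U\times(\mathbb{R}^{m_r}\oplus\mathbb{R}^{m_r})$ and $H\in\mathcal{C}^\infty(U)$ consider $$\big(\tfrac{\mathrm{d}}{\mathrm{d}t}x,f,-y,\nabla H(x),e,u\big)\in\mathcal{D}_x,\qquad(f,e)\in\mathcal{R}_x.\qquad( * )$$ Elements of behaviours are curves $(f,y,e,u)$ in the corresponding trivial bundle over $U$, so they include their base curve $x$. $\mathfrak{B}^{\mathrm{c}}_{\mathcal{D},\mathcal{R},H}(I)$ is the set of continuous $(f,y,e,u)$ whose base curve $x$ is in $\mathcal{C}^1(I,U)$ and for which $( * )$ holds at every point. $\mathfrak{B}^{\mathrm{w}}_{\mathcal{D},\mathcal{R},H}(I)$ is the set of $\mathcal{L}^1$ curves $(f,y,e,u)$ whose base curve is in $(\mathcal{C}\cap W^{1,1})(I,U)$ and for which both relations of $( * )$ hold in the weak sense. For the interconnected system ($\mathcal{D}_1\Vert_{\mathcal{D}_{\mathrm{int}}}\mathcal{D}_2$) the state space is $U_1\times U_2$, there is no external port ($m_p=0$),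 and the Hamiltonian is $(x_1,x_2)\mapsto H_1(x_1)+H_2(x_2)$. The behavioural interconnection $\big(\mathfrak{B}^{\mathfrak{t}}_{\mathcal{D}_1,\mathcal{R}_1,H_1}\Vert_{\mathcal{D}_{\mathrm{int}}}\mathfrak{B}^{\mathfrak{t}}_{\mathcal{D}_2,\mathcal{R}_2,H_2}\big)(I)$ is the set of curves $(f_1,f_2,e_1,e_2)$ (with base curve $(x_1,x_2)$ in $U_1\times U_2$) for which there exists a curve $(\zeta_1,\zeta_2,u_1,u_2):I\to\mathcal{D}_{\mathrm{int}}$ over the same base curve with $(f_i,-\zeta_i,e_i,u_i)\in\mathfrak{B}^{\mathfrak{t}}_{\mathcal{D}_i,\mathcal{R}_i,H_i}(I)$ for $i=1,2$. *)

theory Defs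
  imports "HOL-Analysis.Analysis"
begin

section \<open>The zero-dimensional space\<close>

text \<open>
  The interconnected system has no external port, i.e. its port space is the zero-dimensional
  space. As \<^typ>\<open>real ^ 'n\<close> is never zero-dimensional, \<^typ>\<open>unit\<close> is made a (trivial) inner
  product space.
\<close>

instantiation unit :: real_inner
begin

definition zero_unit :: unit where "zero_unit = ()"
definition plus_unit :: "unit \<Rightarrow> unit \<Rightarrow> unit" where "plus_unit a b = ()"
definition scaleR_unit :: "real \<Rightarrow> unit \<Rightarrow> unit" where "scaleR_unit r a = ()"
definition inner_unit :: "unit \<Rightarrow> unit \<Rightarrow> real" where "inner_unit a b = 0"
definition norm_unit :: "unit \<Rightarrow> real" where "norm_unit a = 0"
definition sgn_unit :: "unit \<Rightarrow> unit" where "sgn_unit a = ()"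
definition dist_unit :: "unit \<Rightarrow> unit \<Rightarrow> real" where "dist_unit a b = 0"
definition uniformity_unit :: "(unit \<times> unit) filter" where
  "uniformity_unit = (INF e\<in>{0 <..}. principal {(x, y). dist x y < e})"
definition open_unit :: "unit set \<Rightarrow> bool" where
  "open_unit U \<longleftrightarrow> (\<forall>x\<in>U. \<forall>\<^sub>F (x', y) in uniformity. x' = x \<longrightarrow> y \<in> U)"

instance
  by standard
    (auto simp: inner_unit_def norm_unit_def dist_unit_def uniformity_unit_def open_unit_def)

end

instance unit :: banach
proof
  fix X :: "nat \<Rightarrow> unit" assume "Cauchy X"
  have "X = (\<lambda>_. ())" by auto
  then show "convergent X" by (simp add: convergent_const)
qed

instance unit :: second_countable_topology
proof
  have "countable (Collect open :: unit set set)"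
    by (rule countable_finite) simp
  moreover have "open = generate_topology (Collect open :: unit set set)"
  proof (intro ext iffI)
    fix S :: "unit set" assume "open S"
    then show "generate_topology (Collect open) S" by (auto intro: generate_topology.Basis)
  next
    fix S :: "unit set" assume "generate_topology (Collect open) S"
    then show "open S" by induct auto
  qed
  ultimately show "\<exists>B::unit set set. countable B \<and> open = generate_topology B" by blast
qed

section \<open>Smooth functions and gradients\<close>

text \<open>
  \<open>Ck_on k f S\<close>, for open \<open>S\<close>: \<open>f\<close> is \<open>k\<close> times continuously differentiable on \<open>S\<close>. The
  derivative is required to exist as a Frechet derivative, and its values in each fixed direction
  have to be of class \<open>k - 1\<close>; in finite dimensions this is the usual notion.
\<close>

primrec Ck_on :: "nat \<Rightarrow> ('a::real_normed_vector \<Rightarrow> 'b::real_normed_vector) \<Rightarrow> 'a set \<Rightarrow> bool" where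
  "Ck_on 0 f S \<longleftrightarrow> continuous_on S f"
| "Ck_on (Suc k) f S \<longleftrightarrow>
     (\<forall>x\<in>S. f differentiable (at x)) \<and>
     (\<forall>v. Ck_on k (\<lambda>x. frechet_derivative f (at x) v) S)"

definition smooth_on :: "'a::real_normed_vector set \<Rightarrow> ('a \<Rightarrow> 'b::real_normed_vector) \<Rightarrow> bool" where
  "smooth_on S f \<longleftrightarrow> (\<forall>k. Ck_on k f S)"

definition grad :: "('a::real_inner \<Rightarrow> real) \<Rightarrow> 'a \<Rightarrow> 'a" where
  "grad H x = (THE D. GDERIV H x :> D)"

section \<open>Pairings, and fibrewise relations in the weak sense\<close>

text \<open>
  A subbundle of a trivial bundle over \<open>U\<close> is given by its fibres, a function from base points to
  sets of pairs (flow, effort); only its values on \<open>U\<close> matter.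
\<close>

definition sym_pairing :: "'v::real_inner \<times> 'v \<Rightarrow> 'v \<times> 'v \<Rightarrow> real" where
  "sym_pairing p q = snd q \<bullet> fst p + snd p \<bullet> fst q"

definition skew_pairing :: "'v::real_inner \<times> 'v \<Rightarrow> 'v \<times> 'v \<Rightarrow> real" where
  "skew_pairing p q = snd q \<bullet> fst p - snd p \<bullet> fst q"

definition compact_support_in :: "real \<Rightarrow> real \<Rightarrow> (real \<Rightarrow> 'v::real_vector) \<Rightarrow> bool" where
  "compact_support_in t0 t1 \<phi> \<longleftrightarrow>
     (\<exists>K. compact K \<and> K \<subseteq> {t0<..<t1} \<and> (\<forall>t\<in>{t0..t1} - K. \<phi> t = 0))"

definition weakly_in ::
  "('v::real_inner \<times> 'v \<Rightarrow> 'v \<times> 'v \<Rightarrow> real) \<Rightarrow> ('x \<Rightarrow> ('v \<times> 'v) set) \<Rightarrow>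
   real \<Rightarrow> real \<Rightarrow> (real \<Rightarrow> 'x) \<Rightarrow> (real \<Rightarrow> 'v \<times> 'v) \<Rightarrow> bool" where
  "weakly_in pairing E t0 t1 x c \<longleftrightarrow>
     (\<forall>\<psi>. continuous_on {t0..t1} \<psi> \<and> compact_support_in t0 t1 \<psi> \<and>
          (\<forall>t\<in>{t0..t1}. \<psi> t \<in> E (x t)) \<longrightarrow>
          (LINT t:{t0..t1}|lebesgue. pairing (c t) (\<psi> t)) = 0)"

abbreviation weakly_in_dirac where "weakly_in_dirac \<equiv> weakly_in sym_pairing"

abbreviation weakly_in_lagrangian where "weakly_in_lagrangian \<equiv> weakly_in skew_pairing"

section \<open>Function spaces\<close>

text \<open>
  Curves on \<open>[t0, t1]\<close> are total functions on \<^typ>\<open>real\<close> whose values outside \<open>[t0, t1]\<close> are never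
  used. Likewise an element of \<open>L\<^sup>1\<close> is represented by its representatives: the weak notions below
  do not change when a curve is modified on a null set, so an equality of sets of representatives
  is an equality of sets of classes.
\<close>

definition C1_curve :: "real \<Rightarrow> real \<Rightarrow> 'x::real_normed_vector set \<Rightarrow> (real \<Rightarrow> 'x) \<Rightarrow> bool" where
  "C1_curve t0 t1 U x \<longleftrightarrow>
     (\<exists>a b g. a < t0 \<and> t1 < b \<and> g C1_differentiable_on {a<..<b} \<and> g ` {a<..<b} \<subseteq> U \<and>
              (\<forall>t\<in>{t0..t1}. x t = g t))"

definition weak_derivative ::
  "real \<Rightarrow> real \<Rightarrow> (real \<Rightarrow> 'x::euclidean_space) \<Rightarrow> (real \<Rightarrow> 'x) \<Rightarrow> bool" where
  "weak_derivative t0 t1 x v \<longleftrightarrow>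
     (\<forall>\<phi> :: real \<Rightarrow> real. smooth_on UNIV \<phi> \<and> (\<exists>K. compact K \<and> K \<subseteq> {t0<..<t1} \<and> (\<forall>t. t \<notin> K \<longrightarrow> \<phi> t = 0)) \<longrightarrow>
        (LINT t:{t0..t1}|lebesgue. deriv \<phi> t *\<^sub>R x t) = - (LINT t:{t0..t1}|lebesgue. \<phi> t *\<^sub>R v t))"

section \<open>Behaviours\<close>

datatype solution_type = Classical | Weak

text \<open>
  Elements of a behaviour are tuples \<open>(x, f, y, e, u)\<close> consisting of the base curve \<open>x\<close> and the
  curve \<open>(f, y, e, u)\<close> over it.
\<close>

type_synonym ('x, 'r, 'p) curve =
  "(real \<Rightarrow> 'x) \<times> (real \<Rightarrow> 'r) \<times> (real \<Rightarrow> 'p) \<times> (real \<Rightarrow> 'r) \<times> (real \<Rightarrow> 'p)"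

definition classical_behaviour ::
  "'x::euclidean_space set \<Rightarrow>
   ('x \<Rightarrow> (('x \<times> 'r::euclidean_space \<times> 'p::{real_inner,banach,second_countable_topology})
            \<times> ('x \<times> 'r \<times> 'p)) set) \<Rightarrow>
   ('x \<Rightarrow> ('r \<times> 'r) set) \<Rightarrow> ('x \<Rightarrow> real) \<Rightarrow> real \<Rightarrow> real \<Rightarrow> ('x, 'r, 'p) curve set" where
  "classical_behaviour U D R H t0 t1 =
     {(x, f, y, e, u).
        C1_curve t0 t1 U x \<and>
        continuous_on {t0..t1} f \<and> continuous_on {t0..t1} y \<and>
        continuous_on {t0..t1} e \<and> continuous_on {t0..t1} u \<and>
        (\<forall>t\<in>{t0..t1}.
           ((vector_derivative x (at t within {t0..t1}), f t, - y t), (grad H (x t), e t, u t)) \<in> D (x t) \<and>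
           (f t, e t) \<in> R (x t))}"

definition weak_behaviour ::
  "'x::euclidean_space set \<Rightarrow>
   ('x \<Rightarrow> (('x \<times> 'r::euclidean_space \<times> 'p::{real_inner,banach,second_countable_topology})
            \<times> ('x \<times> 'r \<times> 'p)) set) \<Rightarrow>
   ('x \<Rightarrow> ('r \<times> 'r) set) \<Rightarrow> ('x \<Rightarrow> real) \<Rightarrow> real \<Rightarrow> real \<Rightarrow> ('x, 'r, 'p) curve set" where
  "weak_behaviour U D R H t0 t1 =
     {(x, f, y, e, u).
        continuous_on {t0..t1} x \<and> x ` {t0..t1} \<subseteq> U \<and>
        f absolutely_integrable_on {t0..t1} \<and> set_integrable lebesgue {t0..t1} y \<and>
        e absolutely_integrable_on {t0..t1} \<and> set_integrable lebesgue {t0..t1} u \<and>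
        (\<exists>v. v absolutely_integrable_on {t0..t1} \<and> weak_derivative t0 t1 x v \<and>
             weakly_in_dirac D t0 t1 x (\<lambda>t. ((v t, f t, - y t), (grad H (x t), e t, u t)))) \<and>
        weakly_in_lagrangian R t0 t1 x (\<lambda>t. (f t, e t))}"

definition behaviour ::
  "solution_type \<Rightarrow> 'x::euclidean_space set \<Rightarrow>
   ('x \<Rightarrow> (('x \<times> 'r::euclidean_space \<times> 'p::{real_inner,banach,second_countable_topology})
            \<times> ('x \<times> 'r \<times> 'p)) set) \<Rightarrow>
   ('x \<Rightarrow> ('r \<times> 'r) set) \<Rightarrow> ('x \<Rightarrow> real) \<Rightarrow> real \<Rightarrow> real \<Rightarrow> ('x, 'r, 'p) curve set" where
  "behaviour \<tau> = (case \<tau> of Classical \<Rightarrow> classical_behaviour | Weak \<Rightarrow> weak_behaviour)"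

section \<open>Canonical representation and interconnection\<close>

definition canonical_dirac ::
  "('x \<Rightarrow> real^'n^'n) \<Rightarrow> ('x \<Rightarrow> real^'m^'n) \<Rightarrow> 'x \<Rightarrow>
   (((real^'n) \<times> (real^'n) \<times> (real^'m)) \<times> ((real^'n) \<times> (real^'n) \<times> (real^'m))) set" where
  "canonical_dirac J B x =
     {((J x *v \<alpha> + e + B x *v u, - \<alpha>, - (transpose (B x) *v \<alpha>)), (\<alpha>, e, u)) | \<alpha> e u. True}"

definition canonical_resistive :: "('x \<Rightarrow> real^'n^'n) \<Rightarrow> 'x \<Rightarrow> ((real^'n) \<times> (real^'n)) set" where
  "canonical_resistive R x = {(f, R x *v f) | f. True}"

definition interconnection_dirac ::
  "('x \<Rightarrow> real^'m2^'m1) \<Rightarrow> 'x \<Rightarrow> (((real^'m1) \<times> (real^'m2)) \<times> ((real^'m1) \<times> (real^'m2))) set" where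
  "interconnection_dirac A x =
     {((\<zeta>1, \<zeta>2), (- (A x *v \<zeta>2), transpose (A x) *v \<zeta>1)) | \<zeta>1 \<zeta>2. True}"

definition product_resistive ::
  "('x1 \<Rightarrow> ('r1 \<times> 'r1) set) \<Rightarrow> ('x2 \<Rightarrow> ('r2 \<times> 'r2) set) \<Rightarrow>
   'x1 \<times> 'x2 \<Rightarrow> (('r1 \<times> 'r2) \<times> ('r1 \<times> 'r2)) set" where
  "product_resistive R1 R2 = (\<lambda>(x1, x2).
     {((f1, f2), (e1, e2)) | f1 f2 e1 e2. (f1, e1) \<in> R1 x1 \<and> (f2, e2) \<in> R2 x2})"

definition interconnect_dirac ::
  "('x1 \<times> 'x2 \<Rightarrow> (('p1 \<times> 'p2) \<times> ('p1 \<times> 'p2)) set) \<Rightarrow>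
   ('x1 \<Rightarrow> (('x1 \<times> 'r1 \<times> 'p1) \<times> ('x1 \<times> 'r1 \<times> 'p1)) set) \<Rightarrow>
   ('x2 \<Rightarrow> (('x2 \<times> 'r2 \<times> 'p2) \<times> ('x2 \<times> 'r2 \<times> 'p2)) set) \<Rightarrow>
   'x1 \<times> 'x2 \<Rightarrow>
   ((('x1 \<times> 'x2) \<times> ('r1 \<times> 'r2) \<times> unit) \<times> (('x1 \<times> 'x2) \<times> ('r1 \<times> 'r2) \<times> unit)) set" where
  "interconnect_dirac Dint D1 D2 = (\<lambda>(x1, x2).
     {(((v1, v2), (f1, f2), ()), ((\<alpha>1, \<alpha>2), (e1, e2), ())) | v1 v2 f1 f2 \<alpha>1 \<alpha>2 e1 e2.
        \<exists>\<zeta>1 \<zeta>2 w1 w2. ((\<zeta>1, \<zeta>2), (w1, w2)) \<in> Dint (x1, x2) \<and>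
          ((v1, f1, \<zeta>1), (\<alpha>1, e1, w1)) \<in> D1 x1 \<and>
          ((v2, f2, \<zeta>2), (\<alpha>2, e2, w2)) \<in> D2 x2})"

text \<open>
  The curves \<open>y, u :: real \<Rightarrow> unit\<close> carry no information. That the base curve takes its values
  in the product of the two state spaces follows from the membership in both behaviours.
\<close>

definition interconnect_behaviour ::
  "('x1 \<times> 'x2 \<Rightarrow> (('p1::real_vector \<times> 'p2::real_vector) \<times> ('p1 \<times> 'p2)) set) \<Rightarrow>
   (real \<Rightarrow> real \<Rightarrow> ('x1, 'r1, 'p1) curve set) \<Rightarrow>
   (real \<Rightarrow> real \<Rightarrow> ('x2, 'r2, 'p2) curve set) \<Rightarrow>
   real \<Rightarrow> real \<Rightarrow> ('x1 \<times> 'x2, 'r1 \<times> 'r2, unit) curve set" where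
  "interconnect_behaviour Dint \<BB>1 \<BB>2 t0 t1 =
     {(x, f, y, e, u). \<exists>\<zeta>1 \<zeta>2 u1 u2.
        (\<forall>t\<in>{t0..t1}. ((\<zeta>1 t, \<zeta>2 t), (u1 t, u2 t)) \<in> Dint (x t)) \<and>
        (fst \<circ> x, fst \<circ> f, (\<lambda>t. - \<zeta>1 t), fst \<circ> e, u1) \<in> \<BB>1 t0 t1 \<and>
        (snd \<circ> x, snd \<circ> f, (\<lambda>t. - \<zeta>2 t), snd \<circ> e, u2) \<in> \<BB>2 t0 t1}"

end

theory Submission
  imports Defs
begin

text \<open>
  For the weak behaviours no pointwise description of weak membership is needed. A test section of
  the interconnected structure splits into test sections of the two subsystems whose port parts lie
  in the interconnection structure, so they pair to zero with the ports of the curve. Conversely, a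
  curve of the interconnected system determines its ports from the co-energy variables
  \<open>\<nabla>H\<^sub>i\<close>, and with these ports a test section of one subsystem has the same pairing as a suitable
  test section of the interconnected system that has zero costate and effort on the other side.
\<close>

section \<open>Smooth functions and gradients\<close>

text \<open>The difficulty sits in the converse inclusion, which has to produce ports although a
  weakly related curve offers no pointwise equation from which to read them off. They are therefore
  built from the base curve alone, as -B_i^T grad H_i and the inputs that the interconnection
  assigns to these values. Base curves are continuous for both solution types, so the ports are
  continuous, hence integrable on the compact interval, and one choice serves both cases. A mismatch
  remains: the input component of a test section of one subsystem is free, whereas in the
  interconnected structure it is dictated by the costate of the other subsystem. The particular form
  of the ports makes this free component invisible to the pairing.\<close>

lemma smooth_on_imp_continuous_on: "smooth_on S f \<Longrightarrow> continuous_on S f"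
  using Ck_on.simps(1) unfolding smooth_on_def by metis

lemma smooth_on_imp_differentiable: "smooth_on S f \<Longrightarrow> x \<in> S \<Longrightarrow> f differentiable (at x)"
  using Ck_on.simps(2) unfolding smooth_on_def by metis

lemma smooth_on_imp_continuous_on_frechet_derivative:
  "smooth_on S f \<Longrightarrow> continuous_on S (\<lambda>x. frechet_derivative f (at x) v)"
  using Ck_on.simps unfolding smooth_on_def by metis

text \<open>Since \<open>grad\<close> is a definite description, uniqueness is what turns any
  derivative that has been found into the value of \<open>grad\<close>.\<close>

lemma GDERIV_unique:
  assumes "GDERIV H x :> D" "GDERIV H x :> D'"
  shows "D = D'"
proof -
  have "(\<lambda>h. h \<bullet> D) = (\<lambda>h. h \<bullet> D')"
    using assms unfolding gderiv_def by (rule has_derivative_unique)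
  then show ?thesis
    by (metis vector_eq_ldot)
qed

lemma grad_eqI: "GDERIV H x :> D \<Longrightarrow> grad H x = D"
  unfolding grad_def by (blast intro: GDERIV_unique)

text \<open>The sum is the Riesz vector of the Frechet derivative in the standard orthonormal basis.
  This explicit form is chosen because \<open>smooth_on\<close> controls derivatives only in fixed
  directions, which are exactly its coefficients; continuity of the gradient can then be read
  off.\<close>

lemma GDERIV_grad:
  fixes H :: "'a::euclidean_space \<Rightarrow> real"
  assumes "H differentiable (at x)"
  shows "GDERIV H x :> (\<Sum>b\<in>Basis. frechet_derivative H (at x) b *\<^sub>R b)" (is "GDERIV H x :> ?D")
    and "grad H x = (\<Sum>b\<in>Basis. frechet_derivative H (at x) b *\<^sub>R b)"
proof -
  let ?F = "frechet_derivative H (at x)"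
  have F: "(H has_derivative ?F) (at x)"
    using assms frechet_derivative_works by blast
  then have lin: "linear ?F"
    by (rule has_derivative_linear)
  have "?F h = h \<bullet> ?D" for h
  proof -
    have "?F h = ?F (\<Sum>b\<in>Basis. (h \<bullet> b) *\<^sub>R b)"
      by (simp add: euclidean_representation)
    also have "\<dots> = (\<Sum>b\<in>Basis. (h \<bullet> b) * ?F b)"
      by (simp add: linear_sum[OF lin] linear_scale[OF lin])
    also have "\<dots> = h \<bullet> ?D"
      by (simp add: inner_sum_right mult.commute)
    finally show ?thesis .
  qed
  then have "?F = (\<lambda>h. h \<bullet> ?D)"
    by blast
  with F show "GDERIV H x :> ?D"
    unfolding gderiv_def by simp
  then show "grad H x = ?D"
    by (rule grad_eqI)
qed

lemma continuous_on_grad: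
  fixes H :: "'a::euclidean_space \<Rightarrow> real"
  assumes "smooth_on S H"
  shows "continuous_on S (grad H)"
proof -
  have "continuous_on S (\<lambda>x. \<Sum>b\<in>Basis. frechet_derivative H (at x) b *\<^sub>R b)"
    by (intro continuous_intros smooth_on_imp_continuous_on_frechet_derivative assms)
  then show ?thesis
    by (subst continuous_on_cong[OF refl GDERIV_grad(2)])
       (auto intro: smooth_on_imp_differentiable assms)
qed

text \<open>Each summand depends on one projection only, so the chain rule along \<open>fst\<close>
  and \<open>snd\<close> gives a derivative whose representing vector is the pair of gradients. It
  supplies the costate of the interconnected system.\<close>

lemma grad_add_separate:
  fixes H1 :: "'a::euclidean_space \<Rightarrow> real" and H2 :: "'b::euclidean_space \<Rightarrow> real"
  assumes "H1 differentiable (at x1)" "H2 differentiable (at x2)"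
  shows "grad (\<lambda>(x1, x2). H1 x1 + H2 x2) (x1, x2) = (grad H1 x1, grad H2 x2)"
proof (rule grad_eqI)
  have 1: "(H1 has_derivative (\<lambda>h. h \<bullet> grad H1 x1)) (at (fst (x1, x2)))"
    and 2: "(H2 has_derivative (\<lambda>h. h \<bullet> grad H2 x2)) (at (snd (x1, x2)))"
    using GDERIV_grad[OF assms(1)] GDERIV_grad[OF assms(2)] by (simp_all add: gderiv_def)
  have "((\<lambda>z. H1 (fst z) + H2 (snd z)) has_derivative
      (\<lambda>h. fst h \<bullet> grad H1 x1 + snd h \<bullet> grad H2 x2)) (at (x1, x2))"
    by (intro has_derivative_add has_derivative_compose[OF has_derivative_fst[OF has_derivative_ident] 1]
        has_derivative_compose[OF has_derivative_snd[OF has_derivative_ident] 2])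
  then show "GDERIV (\<lambda>(x1, x2). H1 x1 + H2 x2) (x1, x2) :> (grad H1 x1, grad H2 x2)"
    by (simp add: gderiv_def inner_prod_def case_prod_unfold)
qed

section \<open>Curves in a product\<close>

lemma continuous_on_matrix_vector_mult [continuous_intros]:
  fixes M :: "'a::topological_space \<Rightarrow> real^'n^'m"
  assumes "continuous_on S M" "continuous_on S v"
  shows "continuous_on S (\<lambda>t. M t *v v t)"
  unfolding matrix_vector_mult_def using assms by (intro continuous_intros)

lemma continuous_on_transpose [continuous_intros]:
  fixes M :: "'a::topological_space \<Rightarrow> real^'n^'m"
  assumes "continuous_on S M"
  shows "continuous_on S (\<lambda>t. transpose (M t))"
  unfolding transpose_def using assms by (intro continuous_intros)

lemma continuous_on_prod_iff:
  "continuous_on S f \<longleftrightarrow> continuous_on S (fst \<circ> f) \<and> continuous_on S (snd \<circ> f)"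
  using continuous_on_Pair[of S "fst \<circ> f" "snd \<circ> f"]
  by (auto simp: o_def intro: continuous_on_fst continuous_on_snd)

section \<open>Continuously differentiable curves with values in a product\<close>

lemma C1_curve_bounded_linear:
  assumes "bounded_linear h" "h ` U \<subseteq> V" "C1_curve t0 t1 U x"
  shows "C1_curve t0 t1 V (h \<circ> x)"
proof -
  from assms(3) obtain a b g where g: "a < t0" "t1 < b" "g C1_differentiable_on {a<..<b}"
      "g ` {a<..<b} \<subseteq> U" "\<forall>t\<in>{t0..t1}. x t = g t"
    unfolding C1_curve_def by blast
  from g(3) obtain D where D: "\<And>t. t \<in> {a<..<b} \<Longrightarrow> (g has_vector_derivative D t) (at t)"
      "continuous_on {a<..<b} D"
    unfolding C1_differentiable_on_def by blast
  have "(h \<circ> g) C1_differentiable_on {a<..<b}"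
    unfolding C1_differentiable_on_def o_def
  proof (intro exI conjI ballI)
    show "((\<lambda>t. h (g t)) has_vector_derivative h (D t)) (at t)" if "t \<in> {a<..<b}" for t
      using that by (intro bounded_linear.has_vector_derivative[OF assms(1)] D(1))
    show "continuous_on {a<..<b} (\<lambda>t. h (D t))"
      by (rule bounded_linear.continuous_on[OF assms(1) D(2)])
  qed
  moreover have "(h \<circ> g) ` {a<..<b} \<subseteq> V"
    using g(4) assms(2) by (auto simp: image_subset_iff)
  moreover have "\<forall>t\<in>{t0..t1}. (h \<circ> x) t = (h \<circ> g) t"
    using g(5) by simp
  ultimately show ?thesis
    unfolding C1_curve_def using g(1,2) by blast
qed

lemma C1_curve_Times_iff:
  "C1_curve t0 t1 (U1 \<times> U2) x \<longleftrightarrow> C1_curve t0 t1 U1 (fst \<circ> x) \<and> C1_curve t0 t1 U2 (snd \<circ> x)"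
proof (intro iffI conjI)
  assume "C1_curve t0 t1 (U1 \<times> U2) x"
  then show "C1_curve t0 t1 U1 (fst \<circ> x)" "C1_curve t0 t1 U2 (snd \<circ> x)"
    by (auto intro!: C1_curve_bounded_linear[of _ "U1 \<times> U2"] bounded_linear_fst bounded_linear_snd)
next
  assume *: "C1_curve t0 t1 U1 (fst \<circ> x) \<and> C1_curve t0 t1 U2 (snd \<circ> x)"
  from * obtain a1 b1 g1 where g1: "a1 < t0" "t1 < b1" "g1 C1_differentiable_on {a1<..<b1}"
      "g1 ` {a1<..<b1} \<subseteq> U1" "\<forall>t\<in>{t0..t1}. fst (x t) = g1 t"
    unfolding C1_curve_def by auto
  from * obtain a2 b2 g2 where g2: "a2 < t0" "t1 < b2" "g2 C1_differentiable_on {a2<..<b2}"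
      "g2 ` {a2<..<b2} \<subseteq> U2" "\<forall>t\<in>{t0..t1}. snd (x t) = g2 t"
    unfolding C1_curve_def by auto
  from g1(3) obtain D1 where D1: "\<And>t. t \<in> {a1<..<b1} \<Longrightarrow> (g1 has_vector_derivative D1 t) (at t)"
      "continuous_on {a1<..<b1} D1"
    unfolding C1_differentiable_on_def by blast
  from g2(3) obtain D2 where D2: "\<And>t. t \<in> {a2<..<b2} \<Longrightarrow> (g2 has_vector_derivative D2 t) (at t)"
      "continuous_on {a2<..<b2} D2"
    unfolding C1_differentiable_on_def by blast
  \<comment> \<open>The two extensions may live on different open intervals; their intersection
    still reaches beyond both end points.\<close>
  let ?I = "{max a1 a2<..<min b1 b2}"
  let ?g = "\<lambda>t. (g1 t, g2 t)"
  have "?g C1_differentiable_on ?I"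
    unfolding C1_differentiable_on_def
  proof (intro exI conjI ballI)
    show "(?g has_vector_derivative (D1 t, D2 t)) (at t)" if "t \<in> ?I" for t
      using that by (intro has_vector_derivative_Pair D1(1) D2(1)) auto
    show "continuous_on ?I (\<lambda>t. (D1 t, D2 t))"
      by (intro continuous_on_Pair continuous_on_subset[OF D1(2)] continuous_on_subset[OF D2(2)]) auto
  qed
  moreover have "?g ` ?I \<subseteq> U1 \<times> U2"
    using g1(4) g2(4) by (auto simp: image_subset_iff)
  moreover have "max a1 a2 < t0" "t1 < min b1 b2"
    using g1 g2 by auto
  moreover have "\<forall>t\<in>{t0..t1}. x t = ?g t"
    using g1(5) g2(5) by (auto simp: prod_eq_iff)
  ultimately show "C1_curve t0 t1 (U1 \<times> U2) x"
    unfolding C1_curve_def by blast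
qed

lemma C1_curve_imp_mem: "C1_curve t0 t1 U x \<Longrightarrow> t \<in> {t0..t1} \<Longrightarrow> x t \<in> U"
  unfolding C1_curve_def by (smt (verit) atLeastAtMost_iff greaterThanLessThan_iff image_subset_iff)

text \<open>The classical relation uses the derivative within the closed interval. The extension
  past the end points provides it there too, as a restriction of a two-sided derivative.\<close>

lemma C1_curve_has_vector_derivative:
  assumes "C1_curve t0 t1 U x" "t \<in> {t0..t1}"
  shows "(x has_vector_derivative vector_derivative x (at t within {t0..t1})) (at t within {t0..t1})"
proof -
  from assms(1) obtain a b g where g: "a < t0" "t1 < b" "g C1_differentiable_on {a<..<b}"
      "\<forall>t\<in>{t0..t1}. x t = g t"
    unfolding C1_curve_def by blast
  with assms(2) obtain D where "(g has_vector_derivative D) (at t)"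
    unfolding C1_differentiable_on_def by fastforce
  then have "(x has_vector_derivative D) (at t within {t0..t1})"
    using g(4) by (auto intro: has_vector_derivative_transform[OF assms(2)] has_vector_derivative_at_within)
  then show ?thesis
    unfolding vector_derivative_works[symmetric] by (rule differentiableI_vector)
qed

lemma C1_curve_imp_continuous_on: "C1_curve t0 t1 U x \<Longrightarrow> continuous_on {t0..t1} x"
  by (rule continuous_on_vector_derivative) (rule C1_curve_has_vector_derivative)

text \<open>Uniqueness of the derivative within the interval forces the components to agree, and
  this is where \<open>t0 < t1\<close> matters: on a single point every vector is a derivative, and
  the value chosen by \<open>vector_derivative\<close> need not respect components.\<close>

lemma C1_curve_vector_derivative_Times:
  assumes "C1_curve t0 t1 U x" "t0 < t1" "t \<in> {t0..t1}"
  shows "vector_derivative x (at t within {t0..t1})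
    = (vector_derivative (fst \<circ> x) (at t within {t0..t1}),
       vector_derivative (snd \<circ> x) (at t within {t0..t1}))"
proof -
  let ?D = "vector_derivative x (at t within {t0..t1})"
  have D: "(x has_vector_derivative ?D) (at t within {t0..t1})"
    using assms by (intro C1_curve_has_vector_derivative)
  have "((fst \<circ> x) has_vector_derivative fst ?D) (at t within {t0..t1})"
    "((snd \<circ> x) has_vector_derivative snd ?D) (at t within {t0..t1})"
    unfolding o_def by (rule bounded_linear.has_vector_derivative[OF bounded_linear_fst D]
        bounded_linear.has_vector_derivative[OF bounded_linear_snd D])+
  then have "vector_derivative (fst \<circ> x) (at t within {t0..t1}) = fst ?D"
    "vector_derivative (snd \<circ> x) (at t within {t0..t1}) = snd ?D"
    using assms(2,3) vector_derivative_within_cbox[of t0 t1] by (metis box_real(2))+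
  then show ?thesis
    by (simp add: prod_eq_iff)
qed

section \<open>Integrals and weak derivatives, one component at a time\<close>

lemma set_integrable_fst:
  "set_integrable M S f \<Longrightarrow> set_integrable M S (\<lambda>t. fst (f t))"
  unfolding set_integrable_def
  by (drule integrable_bounded_linear[OF bounded_linear_fst]) simp

lemma set_integrable_snd:
  "set_integrable M S f \<Longrightarrow> set_integrable M S (\<lambda>t. snd (f t))"
  unfolding set_integrable_def
  by (drule integrable_bounded_linear[OF bounded_linear_snd]) simp

lemma set_integrable_Pair:
  fixes f :: "'a \<Rightarrow> 'b::{banach,second_countable_topology}"
    and g :: "'a \<Rightarrow> 'c::{banach,second_countable_topology}"
  assumes "set_integrable M S f" "set_integrable M S g"
  shows "set_integrable M S (\<lambda>t. (f t, g t))"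
proof -
  \<comment> \<open>A pair is the sum of the embeddings of its two components, and each embedding is
    bounded linear.\<close>
  have "integrable M (\<lambda>t. (indicat_real S t *\<^sub>R f t, 0 :: 'c) + (0 :: 'b, indicat_real S t *\<^sub>R g t))"
    using assms unfolding set_integrable_def
    by (intro Bochner_Integration.integrable_add
        integrable_bounded_linear[OF bounded_linear_Pair[OF bounded_linear_ident bounded_linear_zero]]
        integrable_bounded_linear[OF bounded_linear_Pair[OF bounded_linear_zero bounded_linear_ident]])
  then show ?thesis
    by (simp add: set_integrable_def)
qed

lemma set_integrable_prod_iff:
  fixes f :: "'a \<Rightarrow> 'b::{banach,second_countable_topology} \<times> 'c::{banach,second_countable_topology}"
  shows "set_integrable M S f \<longleftrightarrow> set_integrable M S (fst \<circ> f) \<and> set_integrable M S (snd \<circ> f)"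
  using set_integrable_Pair[of M S "fst \<circ> f" "snd \<circ> f"] set_integrable_fst[of M S f]
    set_integrable_snd[of M S f]
  by (auto simp: o_def)

text \<open>Integrability matters because a non-integrable function has integral 0 by convention,
  even if one of its components is integrable with a nonzero integral.\<close>

lemma set_lebesgue_integral_prod:
  assumes "set_integrable M S f"
  shows "(LINT t:S|M. f t) = ((LINT t:S|M. fst (f t)), (LINT t:S|M. snd (f t)))"
  using integral_bounded_linear[OF bounded_linear_fst assms[unfolded set_integrable_def]]
    integral_bounded_linear[OF bounded_linear_snd assms[unfolded set_integrable_def]]
  by (simp add: set_lebesgue_integral_def prod_eq_iff)

text \<open>A continuous factor on a compact interval is measurable and bounded, so the product with
  an integrable factor stays integrable. Test functions and test sections are continuous while the
  tested curves are merely integrable, so every pairing below is of this kind.\<close>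

lemma set_integrable_bilinear_continuous:
  fixes f :: "real \<Rightarrow> 'a::euclidean_space" and g :: "real \<Rightarrow> 'b::euclidean_space"
    and h :: "'a \<Rightarrow> 'b \<Rightarrow> 'c::euclidean_space"
  assumes "bilinear h" "continuous_on {a..b} f" "set_integrable lebesgue {a..b} g"
  shows "set_integrable lebesgue {a..b} (\<lambda>t. h (f t) (g t))"
proof (rule absolutely_integrable_bounded_measurable_product[OF assms(1) _ _ _ assms(3)])
  show "f \<in> borel_measurable (lebesgue_on {a..b})"
    by (rule continuous_imp_measurable_on_sets_lebesgue[OF assms(2)]) simp
  show "bounded (f ` {a..b})"
    by (rule compact_imp_bounded[OF compact_continuous_image[OF assms(2) compact_Icc]])
qed simp

lemma bilinear_scaleR: "bilinear (scaleR :: real \<Rightarrow> 'a::euclidean_space \<Rightarrow> 'a)"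
  and bilinear_inner: "bilinear (inner :: 'a::euclidean_space \<Rightarrow> 'a \<Rightarrow> real)"
  by (simp_all add: bilinear_conv_bounded_bilinear bounded_bilinear_scaleR bounded_bilinear_inner)

lemma set_integrable_continuous:
  fixes f :: "real \<Rightarrow> 'a::euclidean_space"
  shows "continuous_on {a..b} f \<Longrightarrow> set_integrable lebesgue {a..b} f"
  by (rule absolutely_integrable_continuous_real)

lemma weak_derivative_prod_iff:
  fixes x v :: "real \<Rightarrow> 'a::euclidean_space \<times> 'b::euclidean_space"
  assumes x: "continuous_on {t0..t1} x" and v: "set_integrable lebesgue {t0..t1} v"
  shows "weak_derivative t0 t1 x v \<longleftrightarrow>
    weak_derivative t0 t1 (fst \<circ> x) (fst \<circ> v) \<and> weak_derivative t0 t1 (snd \<circ> x) (snd \<circ> v)"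
proof -
  have "(LINT t:{t0..t1}|lebesgue. deriv \<phi> t *\<^sub>R x t) = - (LINT t:{t0..t1}|lebesgue. \<phi> t *\<^sub>R v t) \<longleftrightarrow>
     (LINT t:{t0..t1}|lebesgue. deriv \<phi> t *\<^sub>R fst (x t)) = - (LINT t:{t0..t1}|lebesgue. \<phi> t *\<^sub>R fst (v t)) \<and>
     (LINT t:{t0..t1}|lebesgue. deriv \<phi> t *\<^sub>R snd (x t)) = - (LINT t:{t0..t1}|lebesgue. \<phi> t *\<^sub>R snd (v t))"
    if \<phi>: "smooth_on UNIV \<phi>" for \<phi> :: "real \<Rightarrow> real"
  proof -
    \<comment> \<open>\<open>smooth_on\<close> speaks of Frechet derivatives and
      \<open>weak_derivative\<close> of \<open>deriv\<close>; evaluating in direction 1 links them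
      and yields the continuity of \<open>deriv \<phi>\<close>.\<close>
    have "deriv \<phi> t = frechet_derivative \<phi> (at t) 1" for t
    proof -
      have D: "(\<phi> has_derivative frechet_derivative \<phi> (at t)) (at t)"
        using smooth_on_imp_differentiable[OF \<phi>] frechet_derivative_works by blast
      have "frechet_derivative \<phi> (at t) = (*) (frechet_derivative \<phi> (at t) 1)"
      proof
        show "frechet_derivative \<phi> (at t) h = frechet_derivative \<phi> (at t) 1 * h" for h
          using linear_scale[OF has_derivative_linear[OF D], of h 1] by simp
      qed
      with D have "(\<phi> has_field_derivative frechet_derivative \<phi> (at t) 1) (at t)"
        by (simp add: has_field_derivative_def)
      then show ?thesis
        by (rule DERIV_imp_deriv)
    qed
    then have "continuous_on UNIV (deriv \<phi>)"
      using smooth_on_imp_continuous_on_frechet_derivative[OF \<phi>, of 1] by simp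
    then have "set_integrable lebesgue {t0..t1} (\<lambda>t. deriv \<phi> t *\<^sub>R x t)"
      by (intro set_integrable_continuous continuous_on_scaleR x)
         (rule continuous_on_subset[OF _ subset_UNIV])
    moreover have "set_integrable lebesgue {t0..t1} (\<lambda>t. \<phi> t *\<^sub>R v t)"
      by (rule set_integrable_bilinear_continuous[OF bilinear_scaleR _ v])
         (rule continuous_on_subset[OF smooth_on_imp_continuous_on[OF \<phi>] subset_UNIV])
    ultimately show ?thesis
      by (simp add: set_lebesgue_integral_prod)
  qed
  then show ?thesis
    unfolding weak_derivative_def o_def by blast
qed

section \<open>Weak membership in interconnected structures\<close>

text \<open>The same compact set serves both functions. The typical \<psi> arises from \<phi> by
  linear operations at each time and hence vanishes wherever \<phi> does.\<close>

lemma compact_support_in_mono: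
  assumes "compact_support_in t0 t1 \<phi>" "\<And>t. t \<in> {t0..t1} \<Longrightarrow> \<phi> t = 0 \<Longrightarrow> \<psi> t = 0"
  shows "compact_support_in t0 t1 \<psi>"
  using assms unfolding compact_support_in_def by blast

lemma weakly_inD:
  assumes "weakly_in p E t0 t1 x c" "continuous_on {t0..t1} \<psi>" "compact_support_in t0 t1 \<psi>"
    "\<And>t. t \<in> {t0..t1} \<Longrightarrow> \<psi> t \<in> E (x t)"
  shows "(LINT t:{t0..t1}|lebesgue. p (c t) (\<psi> t)) = 0"
  using assms unfolding weakly_in_def by blast

lemma set_integrable_sym_pairing:
  fixes c \<psi> :: "real \<Rightarrow> 'v::euclidean_space \<times> 'v"
  assumes "set_integrable lebesgue {a..b} c" "continuous_on {a..b} \<psi>"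
  shows "set_integrable lebesgue {a..b} (\<lambda>t. sym_pairing (c t) (\<psi> t))"
  \<comment> \<open>Commuting the second inner product puts the continuous factor first in both
    summands, as \<open>set_integrable_bilinear_continuous\<close> expects.\<close>
  unfolding sym_pairing_def inner_commute[of "snd (c _)"]
  by (intro set_integral_add set_integrable_bilinear_continuous[OF bilinear_inner] set_integrable_fst
      set_integrable_snd continuous_on_fst continuous_on_snd assms)

lemma set_integrable_skew_pairing:
  fixes c \<psi> :: "real \<Rightarrow> 'v::euclidean_space \<times> 'v"
  assumes "set_integrable lebesgue {a..b} c" "continuous_on {a..b} \<psi>"
  shows "set_integrable lebesgue {a..b} (\<lambda>t. skew_pairing (c t) (\<psi> t))"
  unfolding skew_pairing_def inner_commute[of "snd (c _)"]
  by (intro set_integral_diff set_integrable_bilinear_continuous[OF bilinear_inner] set_integrable_fst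
      set_integrable_snd continuous_on_fst continuous_on_snd assms)

section \<open>Explicit fibres and isotropy of the interconnection\<close>

text \<open>A normal form for pairings: matrices are moved off one argument of the inner product and
  onto the other as row-vector products, so that two ways of distributing a chain of matrices over
  an inner product can be compared by simplification.\<close>

lemma inner_matrix_vector:
  fixes M :: "real^'n^'m"
  shows "v \<bullet> (M *v w) = (v v* M) \<bullet> w" "(M *v w) \<bullet> v = (v v* M) \<bullet> w"
  by (simp_all only: dot_lmul_matrix inner_commute[of "M *v w" v])

lemma matrix_vector_mult_uminus:
  fixes M :: "real^'n^'m"
  shows "M *v (- v) = - (M *v v)"
  using matrix_vector_mult_diff_distrib[of M 0 v] by simp

lemma vector_matrix_mult_uminus:
  fixes M :: "real^'n^'m"
  shows "(- v) v* M = - (v v* M)"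
  using matrix_vector_mult_uminus[of "transpose M" v] by simp

lemma mem_canonical_dirac_iff:
  "((v, f, \<zeta>), (\<alpha>, e, u)) \<in> canonical_dirac J B x \<longleftrightarrow>
     v = J x *v \<alpha> + e + B x *v u \<and> f = - \<alpha> \<and> \<zeta> = - (transpose (B x) *v \<alpha>)"
  by (auto simp: canonical_dirac_def)

lemma mem_canonical_resistive_iff: "(f, e) \<in> canonical_resistive R x \<longleftrightarrow> e = R x *v f"
  by (auto simp: canonical_resistive_def)

lemma mem_interconnection_dirac_iff:
  "((\<zeta>1, \<zeta>2), (w1, w2)) \<in> interconnection_dirac A x \<longleftrightarrow>
     w1 = - (A x *v \<zeta>2) \<and> w2 = transpose (A x) *v \<zeta>1"
  by (auto simp: interconnection_dirac_def)

lemma mem_product_resistive_iff: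
  "((f1, f2), (e1, e2)) \<in> product_resistive R1 R2 (x1, x2) \<longleftrightarrow> (f1, e1) \<in> R1 x1 \<and> (f2, e2) \<in> R2 x2"
  by (auto simp: product_resistive_def)

lemma mem_interconnect_dirac_iff:
  "(((v1, v2), (f1, f2), y), ((\<alpha>1, \<alpha>2), (e1, e2), u)) \<in> interconnect_dirac Dint D1 D2 (x1, x2) \<longleftrightarrow>
     (\<exists>\<zeta>1 \<zeta>2 w1 w2. ((\<zeta>1, \<zeta>2), (w1, w2)) \<in> Dint (x1, x2) \<and>
        ((v1, f1, \<zeta>1), (\<alpha>1, e1, w1)) \<in> D1 x1 \<and> ((v2, f2, \<zeta>2), (\<alpha>2, e2, w2)) \<in> D2 x2)"
  by (auto simp: interconnect_dirac_def)

text \<open>The ports can be eliminated: \<open>\<zeta>i = - Bi^T \<alpha>i\<close> is forced by the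
  subsystems, and the interconnection then forces \<open>w1 = A B2^T \<alpha>2\<close> and
  \<open>w2 = - A^T B1^T \<alpha>1\<close>. This is the origin of the opposite signs of the two
  coupling terms.\<close>

lemma mem_interconnect_canonical_dirac_iff:
  fixes A :: "(real^'n1) \<times> (real^'n2) \<Rightarrow> real^'m2^'m1"
  shows "(((v1, v2), (f1, f2), y), ((\<alpha>1, \<alpha>2), (e1, e2), u))
    \<in> interconnect_dirac (interconnection_dirac A) (canonical_dirac J1 B1) (canonical_dirac J2 B2) (x1, x2)
  \<longleftrightarrow> v1 = J1 x1 *v \<alpha>1 + e1 + B1 x1 *v (A (x1, x2) *v (transpose (B2 x2) *v \<alpha>2)) \<and>
      v2 = J2 x2 *v \<alpha>2 + e2 - B2 x2 *v (transpose (A (x1, x2)) *v (transpose (B1 x1) *v \<alpha>1)) \<and>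
      f1 = - \<alpha>1 \<and> f2 = - \<alpha>2"
  by (auto simp: mem_interconnect_dirac_iff mem_interconnection_dirac_iff mem_canonical_dirac_iff
      matrix_vector_mult_uminus vector_matrix_mult_uminus)

text \<open>The blocks -A and A^T are negative transposes of each other, so the map from
  \<open>(\<zeta>1, \<zeta>2)\<close> to \<open>(w1, w2)\<close> is skew-symmetric. Physically, the
  interconnection conserves power.\<close>

lemma sym_pairing_interconnection_dirac:
  assumes "p \<in> interconnection_dirac A x" "q \<in> interconnection_dirac A x"
  shows "sym_pairing p q = 0"
  using assms
  by (auto simp: interconnection_dirac_def sym_pairing_def inner_matrix_vector inner_commute)

text \<open>The pairing of the interconnected system is the sum of the two subsystem pairings minus
  the pairing of the port parts. The latter vanishes at each time because \<open>int\<close> holds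
  pointwise; \<open>c1\<close> and \<open>c2\<close> allow the integral of the sum to be
  split.\<close>

lemma weakly_in_dirac_interconnect_dirac:
  fixes x :: "real \<Rightarrow> (real^'n1) \<times> (real^'n2)"
    and A :: "(real^'n1) \<times> (real^'n2) \<Rightarrow> real^'m2^'m1"
    and f1 e1 :: "real \<Rightarrow> real^'n1" and f2 e2 :: "real \<Rightarrow> real^'n2"
  assumes B1: "continuous_on {t0..t1} (\<lambda>t. B1 (fst (x t)))"
    and B2: "continuous_on {t0..t1} (\<lambda>t. B2 (snd (x t)))"
    and A: "continuous_on {t0..t1} (\<lambda>t. A (x t))"
    and c1: "set_integrable lebesgue {t0..t1} (\<lambda>t. ((v1 t, f1 t, \<zeta>1 t), (g1 t, e1 t, u1 t)))"
    and c2: "set_integrable lebesgue {t0..t1} (\<lambda>t. ((v2 t, f2 t, \<zeta>2 t), (g2 t, e2 t, u2 t)))"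
    and int: "\<And>t. t \<in> {t0..t1} \<Longrightarrow> ((\<zeta>1 t, \<zeta>2 t), (u1 t, u2 t)) \<in> interconnection_dirac A (x t)"
    and w1: "weakly_in_dirac (canonical_dirac J1 B1) t0 t1 (fst \<circ> x)
      (\<lambda>t. ((v1 t, f1 t, \<zeta>1 t), (g1 t, e1 t, u1 t)))"
    and w2: "weakly_in_dirac (canonical_dirac J2 B2) t0 t1 (snd \<circ> x)
      (\<lambda>t. ((v2 t, f2 t, \<zeta>2 t), (g2 t, e2 t, u2 t)))"
  shows "weakly_in_dirac
    (interconnect_dirac (interconnection_dirac A) (canonical_dirac J1 B1) (canonical_dirac J2 B2)) t0 t1 x
    (\<lambda>t. (((v1 t, v2 t), (f1 t, f2 t), ()), ((g1 t, g2 t), (e1 t, e2 t), ())))"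
  unfolding weakly_in_def
proof (intro allI impI, elim conjE)
  fix \<psi> :: "real \<Rightarrow> (((real^'n1) \<times> (real^'n2)) \<times> ((real^'n1) \<times> (real^'n2)) \<times> unit)
    \<times> (((real^'n1) \<times> (real^'n2)) \<times> ((real^'n1) \<times> (real^'n2)) \<times> unit)"
  assume cont: "continuous_on {t0..t1} \<psi>" and supp: "compact_support_in t0 t1 \<psi>"
    and mem: "\<forall>t\<in>{t0..t1}. \<psi> t \<in>
      interconnect_dirac (interconnection_dirac A) (canonical_dirac J1 B1) (canonical_dirac J2 B2) (x t)"
  define V1 V2 F1 F2 a1 a2 b1 b2 where
    "V1 = (\<lambda>t. fst (fst (fst (\<psi> t))))" "V2 = (\<lambda>t. snd (fst (fst (\<psi> t))))"
    "F1 = (\<lambda>t. fst (fst (snd (fst (\<psi> t)))))" "F2 = (\<lambda>t. snd (fst (snd (fst (\<psi> t)))))"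
    "a1 = (\<lambda>t. fst (fst (snd (\<psi> t))))" "a2 = (\<lambda>t. snd (fst (snd (\<psi> t))))"
    "b1 = (\<lambda>t. fst (fst (snd (snd (\<psi> t)))))" "b2 = (\<lambda>t. snd (fst (snd (snd (\<psi> t)))))"
  note defs = this
  have \<psi>: "\<psi> t = (((V1 t, V2 t), (F1 t, F2 t), ()), ((a1 t, a2 t), (b1 t, b2 t), ()))" for t
    by (simp add: defs prod_eq_iff)
  have conts: "continuous_on {t0..t1} V1" "continuous_on {t0..t1} V2"
    "continuous_on {t0..t1} F1" "continuous_on {t0..t1} F2"
    "continuous_on {t0..t1} a1" "continuous_on {t0..t1} a2"
    "continuous_on {t0..t1} b1" "continuous_on {t0..t1} b2"
    unfolding defs by (intro continuous_on_fst continuous_on_snd cont)+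
  \<comment> \<open>Membership of \<psi> only says that ports exist at each time, but test sections
    must be continuous. Since the costates force the ports, these formulas select them
    continuously.\<close>
  define z1 z2 w1 w2 where "z1 = (\<lambda>t. - (transpose (B1 (fst (x t))) *v a1 t))"
    "z2 = (\<lambda>t. - (transpose (B2 (snd (x t))) *v a2 t))"
    "w1 = (\<lambda>t. - (A (x t) *v z2 t))" "w2 = (\<lambda>t. transpose (A (x t)) *v z1 t)"
  note ports = this
  let ?c1 = "\<lambda>t. ((v1 t, f1 t, \<zeta>1 t), (g1 t, e1 t, u1 t))"
  let ?c2 = "\<lambda>t. ((v2 t, f2 t, \<zeta>2 t), (g2 t, e2 t, u2 t))"
  let ?\<psi>1 = "\<lambda>t. ((V1 t, F1 t, z1 t), (a1 t, b1 t, w1 t))"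
  let ?\<psi>2 = "\<lambda>t. ((V2 t, F2 t, z2 t), (a2 t, b2 t, w2 t))"
  have cont1: "continuous_on {t0..t1} ?\<psi>1" and cont2: "continuous_on {t0..t1} ?\<psi>2"
    unfolding ports by (intro continuous_intros conts B1 B2 A)+
  have mem': "?\<psi>1 t \<in> canonical_dirac J1 B1 (fst (x t))" "?\<psi>2 t \<in> canonical_dirac J2 B2 (snd (x t))"
    "((z1 t, z2 t), (w1 t, w2 t)) \<in> interconnection_dirac A (x t)" if "t \<in> {t0..t1}" for t
  proof -
    have "\<psi> t \<in> interconnect_dirac (interconnection_dirac A) (canonical_dirac J1 B1)
        (canonical_dirac J2 B2) (fst (x t), snd (x t))"
      using mem that by simp
    then show "?\<psi>1 t \<in> canonical_dirac J1 B1 (fst (x t))" "?\<psi>2 t \<in> canonical_dirac J2 B2 (snd (x t))"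
      unfolding \<psi> mem_interconnect_canonical_dirac_iff mem_canonical_dirac_iff
      by (simp_all add: ports matrix_vector_mult_uminus vector_matrix_mult_uminus)
    show "((z1 t, z2 t), (w1 t, w2 t)) \<in> interconnection_dirac A (x t)"
      by (simp add: ports mem_interconnection_dirac_iff)
  qed
  \<comment> \<open>The selected ports are linear in the costates, so they vanish together with
    \<psi> and the support condition carries over.\<close>
  have "(LINT t:{t0..t1}|lebesgue. sym_pairing (?c1 t) (?\<psi>1 t)) = 0"
    using supp mem'(1) by (intro weakly_inD[OF w1 cont1])
      (auto elim!: compact_support_in_mono simp: \<psi> ports zero_prod_def)
  moreover have "(LINT t:{t0..t1}|lebesgue. sym_pairing (?c2 t) (?\<psi>2 t)) = 0"
    using supp mem'(2) by (intro weakly_inD[OF w2 cont2])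
      (auto elim!: compact_support_in_mono simp: \<psi> ports zero_prod_def)
  moreover have "(LINT t:{t0..t1}|lebesgue.
      sym_pairing (((v1 t, v2 t), (f1 t, f2 t), ()), ((g1 t, g2 t), (e1 t, e2 t), ())) (\<psi> t))
    = (LINT t:{t0..t1}|lebesgue. sym_pairing (?c1 t) (?\<psi>1 t) + sym_pairing (?c2 t) (?\<psi>2 t))"
  proof (intro set_lebesgue_integral_cong allI impI)
    fix t assume t: "t \<in> {t0..t1}"
    show "sym_pairing (((v1 t, v2 t), (f1 t, f2 t), ()), ((g1 t, g2 t), (e1 t, e2 t), ())) (\<psi> t)
      = sym_pairing (?c1 t) (?\<psi>1 t) + sym_pairing (?c2 t) (?\<psi>2 t)"
      using sym_pairing_interconnection_dirac[OF int[OF t] mem'(3)[OF t]]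
      by (simp add: \<psi> sym_pairing_def inner_unit_def)
  qed simp
  moreover have "\<dots> = (LINT t:{t0..t1}|lebesgue. sym_pairing (?c1 t) (?\<psi>1 t))
      + (LINT t:{t0..t1}|lebesgue. sym_pairing (?c2 t) (?\<psi>2 t))"
    by (intro set_integral_add set_integrable_sym_pairing c1 c2 cont1 cont2)
  ultimately show "(LINT t:{t0..t1}|lebesgue.
      sym_pairing (((v1 t, v2 t), (f1 t, f2 t), ()), ((g1 t, g2 t), (e1 t, e2 t), ())) (\<psi> t)) = 0"
    by simp
qed

text \<open>
  With the ports \<open>\<zeta>\<^sub>i = - B\<^sub>i\<^sup>T g\<^sub>i\<close>, the component \<open>w\<close> of a test section of one factor
  drops out of the pairing, so that it may be replaced by the value which extends the test section
  by zero costates and efforts of the other factor.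
\<close>

lemma weakly_in_dirac_interconnect_diracD:
  fixes x :: "real \<Rightarrow> (real^'n1) \<times> (real^'n2)"
    and A :: "(real^'n1) \<times> (real^'n2) \<Rightarrow> real^'m2^'m1"
    and f1 e1 :: "real \<Rightarrow> real^'n1" and f2 e2 :: "real \<Rightarrow> real^'n2"
  assumes B1: "continuous_on {t0..t1} (\<lambda>t. B1 (fst (x t)))"
    and B2: "continuous_on {t0..t1} (\<lambda>t. B2 (snd (x t)))"
    and A: "continuous_on {t0..t1} (\<lambda>t. A (x t))"
    and w: "weakly_in_dirac
      (interconnect_dirac (interconnection_dirac A) (canonical_dirac J1 B1) (canonical_dirac J2 B2)) t0 t1 x
      (\<lambda>t. (((v1 t, v2 t), (f1 t, f2 t), ()), ((g1 t, g2 t), (e1 t, e2 t), ())))"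
    and int: "\<And>t. t \<in> {t0..t1} \<Longrightarrow> ((\<zeta>1 t, \<zeta>2 t), (u1 t, u2 t)) \<in> interconnection_dirac A (x t)"
    and \<zeta>1: "\<And>t. t \<in> {t0..t1} \<Longrightarrow> \<zeta>1 t = - (transpose (B1 (fst (x t))) *v g1 t)"
    and \<zeta>2: "\<And>t. t \<in> {t0..t1} \<Longrightarrow> \<zeta>2 t = - (transpose (B2 (snd (x t))) *v g2 t)"
  shows "weakly_in_dirac (canonical_dirac J1 B1) t0 t1 (fst \<circ> x)
      (\<lambda>t. ((v1 t, f1 t, \<zeta>1 t), (g1 t, e1 t, u1 t)))"
    and "weakly_in_dirac (canonical_dirac J2 B2) t0 t1 (snd \<circ> x)
      (\<lambda>t. ((v2 t, f2 t, \<zeta>2 t), (g2 t, e2 t, u2 t)))"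
proof -
  let ?c = "\<lambda>t. (((v1 t, v2 t), (f1 t, f2 t), ()), ((g1 t, g2 t), (e1 t, e2 t), ()))"
  show "weakly_in_dirac (canonical_dirac J1 B1) t0 t1 (fst \<circ> x)
      (\<lambda>t. ((v1 t, f1 t, \<zeta>1 t), (g1 t, e1 t, u1 t)))"
    unfolding weakly_in_def
  proof (intro allI impI, elim conjE)
    fix \<psi> :: "real \<Rightarrow> ((real^'n1) \<times> (real^'n1) \<times> (real^'m1)) \<times> ((real^'n1) \<times> (real^'n1) \<times> (real^'m1))"
    assume cont: "continuous_on {t0..t1} \<psi>" and supp: "compact_support_in t0 t1 \<psi>"
      and mem: "\<forall>t\<in>{t0..t1}. \<psi> t \<in> canonical_dirac J1 B1 ((fst \<circ> x) t)"
    define V F z a b w where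
      "V = (\<lambda>t. fst (fst (\<psi> t)))" "F = (\<lambda>t. fst (snd (fst (\<psi> t))))" "z = (\<lambda>t. snd (snd (fst (\<psi> t))))"
      "a = (\<lambda>t. fst (snd (\<psi> t)))" "b = (\<lambda>t. fst (snd (snd (\<psi> t))))" "w = (\<lambda>t. snd (snd (snd (\<psi> t))))"
    note defs = this
    have \<psi>: "\<psi> t = ((V t, F t, z t), (a t, b t, w t))" for t
      by (simp add: defs)
    have conts: "continuous_on {t0..t1} V" "continuous_on {t0..t1} F"
      "continuous_on {t0..t1} a" "continuous_on {t0..t1} b" "continuous_on {t0..t1} w"
      unfolding defs by (intro continuous_on_fst continuous_on_snd cont)+
    have eqs: "V t = J1 (fst (x t)) *v a t + b t + B1 (fst (x t)) *v w t" "F t = - a t"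
      "z t = - (transpose (B1 (fst (x t))) *v a t)" if "t \<in> {t0..t1}" for t
      using mem that by (auto simp: \<psi> mem_canonical_dirac_iff)
    \<comment> \<open>With zero costate on the second side the forced input of the first subsystem
      is 0, so \<open>B1 w\<close> is removed from its flow. The costate \<open>a\<close> in turn
      forces the input \<open>- A^T B1^T a\<close> on the second subsystem, whose state flow is then
      \<open>- B2 A^T B1^T a\<close>.\<close>
    let ?\<psi> = "\<lambda>t. (((V t - B1 (fst (x t)) *v w t,
         - (B2 (snd (x t)) *v (transpose (A (x t)) *v (transpose (B1 (fst (x t))) *v a t)))),
        (F t, 0), ()), ((a t, 0), (b t, 0), ()))"
    have "(LINT t:{t0..t1}|lebesgue. sym_pairing (?c t) (?\<psi> t)) = 0"
    proof (rule weakly_inD[OF w])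
      show "continuous_on {t0..t1} ?\<psi>"
        by (intro continuous_intros conts B1 B2 A)
      show "compact_support_in t0 t1 ?\<psi>"
        using supp by (rule compact_support_in_mono) (simp add: \<psi> zero_prod_def zero_unit_def)
      show "?\<psi> t \<in> interconnect_dirac (interconnection_dirac A) (canonical_dirac J1 B1)
          (canonical_dirac J2 B2) (x t)" if "t \<in> {t0..t1}" for t
        using eqs[OF that] by (subst prod.collapse[of "x t", symmetric],
            unfold mem_interconnect_canonical_dirac_iff) simp
    qed
    moreover have "(LINT t:{t0..t1}|lebesgue. sym_pairing ((v1 t, f1 t, \<zeta>1 t), (g1 t, e1 t, u1 t)) (\<psi> t))
      = (LINT t:{t0..t1}|lebesgue. sym_pairing (?c t) (?\<psi> t))"
    proof (intro set_lebesgue_integral_cong allI impI)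
      fix t assume t: "t \<in> {t0..t1}"
      \<comment> \<open>Two exchanges are at work. The products of \<open>w\<close> with
        \<open>\<zeta>1 = - B1^T g1\<close> and of \<open>g1\<close> with \<open>B1 w\<close>
        cancel. The product of \<open>u1 = A B2^T g2\<close> with \<open>z = - B1^T a\<close> equals
        that of \<open>g2\<close> with the added flow \<open>- B2 A^T B1^T a\<close>.\<close>
      show "sym_pairing ((v1 t, f1 t, \<zeta>1 t), (g1 t, e1 t, u1 t)) (\<psi> t) = sym_pairing (?c t) (?\<psi> t)"
        using int[OF t]
        by (simp add: \<psi> eqs[OF t] \<zeta>1[OF t] \<zeta>2[OF t] mem_interconnection_dirac_iff sym_pairing_def
            inner_unit_def inner_matrix_vector inner_simps matrix_vector_mult_uminus
            vector_matrix_mult_uminus inner_commute)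
    qed simp
    ultimately show "(LINT t:{t0..t1}|lebesgue.
        sym_pairing ((v1 t, f1 t, \<zeta>1 t), (g1 t, e1 t, u1 t)) (\<psi> t)) = 0"
      by simp
  qed
  show "weakly_in_dirac (canonical_dirac J2 B2) t0 t1 (snd \<circ> x)
      (\<lambda>t. ((v2 t, f2 t, \<zeta>2 t), (g2 t, e2 t, u2 t)))"
    unfolding weakly_in_def
  proof (intro allI impI, elim conjE)
    fix \<psi> :: "real \<Rightarrow> ((real^'n2) \<times> (real^'n2) \<times> (real^'m2)) \<times> ((real^'n2) \<times> (real^'n2) \<times> (real^'m2))"
    assume cont: "continuous_on {t0..t1} \<psi>" and supp: "compact_support_in t0 t1 \<psi>"
      and mem: "\<forall>t\<in>{t0..t1}. \<psi> t \<in> canonical_dirac J2 B2 ((snd \<circ> x) t)"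
    define V F z a b w where
      "V = (\<lambda>t. fst (fst (\<psi> t)))" "F = (\<lambda>t. fst (snd (fst (\<psi> t))))" "z = (\<lambda>t. snd (snd (fst (\<psi> t))))"
      "a = (\<lambda>t. fst (snd (\<psi> t)))" "b = (\<lambda>t. fst (snd (snd (\<psi> t))))" "w = (\<lambda>t. snd (snd (snd (\<psi> t))))"
    note defs = this
    have \<psi>: "\<psi> t = ((V t, F t, z t), (a t, b t, w t))" for t
      by (simp add: defs)
    have conts: "continuous_on {t0..t1} V" "continuous_on {t0..t1} F"
      "continuous_on {t0..t1} a" "continuous_on {t0..t1} b" "continuous_on {t0..t1} w"
      unfolding defs by (intro continuous_on_fst continuous_on_snd cont)+
    have eqs: "V t = J2 (snd (x t)) *v a t + b t + B2 (snd (x t)) *v w t" "F t = - a t"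
      "z t = - (transpose (B2 (snd (x t))) *v a t)" if "t \<in> {t0..t1}" for t
      using mem that by (auto simp: \<psi> mem_canonical_dirac_iff)
    \<comment> \<open>The mirror image, with a positive coupling term: a costate \<open>a\<close> of
      the second subsystem forces the input \<open>A B2^T a\<close> on the first.\<close>
    let ?\<psi> = "\<lambda>t. (((B1 (fst (x t)) *v (A (x t) *v (transpose (B2 (snd (x t))) *v a t)),
         V t - B2 (snd (x t)) *v w t),
        (0, F t), ()), ((0, a t), (0, b t), ()))"
    have "(LINT t:{t0..t1}|lebesgue. sym_pairing (?c t) (?\<psi> t)) = 0"
    proof (rule weakly_inD[OF w])
      show "continuous_on {t0..t1} ?\<psi>"
        by (intro continuous_intros conts B1 B2 A)
      show "compact_support_in t0 t1 ?\<psi>"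
        using supp by (rule compact_support_in_mono) (simp add: \<psi> zero_prod_def zero_unit_def)
      show "?\<psi> t \<in> interconnect_dirac (interconnection_dirac A) (canonical_dirac J1 B1)
          (canonical_dirac J2 B2) (x t)" if "t \<in> {t0..t1}" for t
        using eqs[OF that] by (subst prod.collapse[of "x t", symmetric],
            unfold mem_interconnect_canonical_dirac_iff) simp
    qed
    moreover have "(LINT t:{t0..t1}|lebesgue. sym_pairing ((v2 t, f2 t, \<zeta>2 t), (g2 t, e2 t, u2 t)) (\<psi> t))
      = (LINT t:{t0..t1}|lebesgue. sym_pairing (?c t) (?\<psi> t))"
    proof (intro set_lebesgue_integral_cong allI impI)
      fix t assume t: "t \<in> {t0..t1}"
      show "sym_pairing ((v2 t, f2 t, \<zeta>2 t), (g2 t, e2 t, u2 t)) (\<psi> t) = sym_pairing (?c t) (?\<psi> t)"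
        using int[OF t]
        by (simp add: \<psi> eqs[OF t] \<zeta>1[OF t] \<zeta>2[OF t] mem_interconnection_dirac_iff sym_pairing_def
            inner_unit_def inner_matrix_vector inner_simps matrix_vector_mult_uminus
            vector_matrix_mult_uminus inner_commute)
    qed simp
    ultimately show "(LINT t:{t0..t1}|lebesgue.
        sym_pairing ((v2 t, f2 t, \<zeta>2 t), (g2 t, e2 t, u2 t)) (\<psi> t)) = 0"
      by simp
  qed
qed

text \<open>Restricting to a factor extends test sections by zero in the other one, so both fibres
  must contain zero. Recombining adds the two pairings, and there the integrability of
  \<open>f\<close> and \<open>e\<close> lets the integral split.\<close>

lemma weakly_in_lagrangian_product_resistive_iff:
  fixes f e :: "real \<Rightarrow> 'r1::euclidean_space \<times> 'r2::euclidean_space"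
  assumes f: "set_integrable lebesgue {t0..t1} f" and e: "set_integrable lebesgue {t0..t1} e"
    and zero1: "\<And>y. (0, 0) \<in> R1 y" and zero2: "\<And>y. (0, 0) \<in> R2 y"
  shows "weakly_in_lagrangian (product_resistive R1 R2) t0 t1 x (\<lambda>t. (f t, e t)) \<longleftrightarrow>
    weakly_in_lagrangian R1 t0 t1 (fst \<circ> x) (\<lambda>t. ((fst \<circ> f) t, (fst \<circ> e) t)) \<and>
    weakly_in_lagrangian R2 t0 t1 (snd \<circ> x) (\<lambda>t. ((snd \<circ> f) t, (snd \<circ> e) t))"
  (is "?L \<longleftrightarrow> ?L1 \<and> ?L2")
proof (intro iffI conjI)
  have mem: "((\<phi>1, \<phi>2), (\<epsilon>1, \<epsilon>2)) \<in> product_resistive R1 R2 (x t) \<longleftrightarrow>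
      (\<phi>1, \<epsilon>1) \<in> R1 (fst (x t)) \<and> (\<phi>2, \<epsilon>2) \<in> R2 (snd (x t))" for \<phi>1 \<phi>2 \<epsilon>1 \<epsilon>2 t
    using mem_product_resistive_iff[of _ _ _ _ R1 R2 "fst (x t)" "snd (x t)"] by simp
  {
    assume L: ?L
    show ?L1
      unfolding weakly_in_def
    proof (intro allI impI, elim conjE)
      fix \<psi> :: "real \<Rightarrow> 'r1 \<times> 'r1"
      assume cont: "continuous_on {t0..t1} \<psi>" and supp: "compact_support_in t0 t1 \<psi>"
        and "\<forall>t\<in>{t0..t1}. \<psi> t \<in> R1 ((fst \<circ> x) t)"
      then have "(LINT t:{t0..t1}|lebesgue.
          skew_pairing (f t, e t) ((fst (\<psi> t), 0), (snd (\<psi> t), 0))) = 0"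
        by (intro weakly_inD[OF L] compact_support_in_mono[OF supp] continuous_intros)
           (auto simp: mem zero2 zero_prod_def)
      then show "(LINT t:{t0..t1}|lebesgue. skew_pairing ((fst \<circ> f) t, (fst \<circ> e) t) (\<psi> t)) = 0"
        by (simp add: skew_pairing_def inner_prod_def)
    qed
    show ?L2
      unfolding weakly_in_def
    proof (intro allI impI, elim conjE)
      fix \<psi> :: "real \<Rightarrow> 'r2 \<times> 'r2"
      assume cont: "continuous_on {t0..t1} \<psi>" and supp: "compact_support_in t0 t1 \<psi>"
        and "\<forall>t\<in>{t0..t1}. \<psi> t \<in> R2 ((snd \<circ> x) t)"
      then have "(LINT t:{t0..t1}|lebesgue.
          skew_pairing (f t, e t) ((0, fst (\<psi> t)), (0, snd (\<psi> t)))) = 0"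
        by (intro weakly_inD[OF L] compact_support_in_mono[OF supp] continuous_intros)
           (auto simp: mem zero1 zero_prod_def)
      then show "(LINT t:{t0..t1}|lebesgue. skew_pairing ((snd \<circ> f) t, (snd \<circ> e) t) (\<psi> t)) = 0"
        by (simp add: skew_pairing_def inner_prod_def)
    qed
  next
    assume L12: "?L1 \<and> ?L2"
    show ?L
      unfolding weakly_in_def
    proof (intro allI impI, elim conjE)
      fix \<psi> :: "real \<Rightarrow> ('r1 \<times> 'r2) \<times> ('r1 \<times> 'r2)"
      assume cont: "continuous_on {t0..t1} \<psi>" and supp: "compact_support_in t0 t1 \<psi>"
        and \<psi>: "\<forall>t\<in>{t0..t1}. \<psi> t \<in> product_resistive R1 R2 (x t)"
      let ?\<psi>1 = "\<lambda>t. (fst (fst (\<psi> t)), fst (snd (\<psi> t)))"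
      let ?\<psi>2 = "\<lambda>t. (snd (fst (\<psi> t)), snd (snd (\<psi> t)))"
      let ?c1 = "\<lambda>t. ((fst \<circ> f) t, (fst \<circ> e) t)" and ?c2 = "\<lambda>t. ((snd \<circ> f) t, (snd \<circ> e) t)"
      have in1: "?\<psi>1 t \<in> R1 ((fst \<circ> x) t)" and in2: "?\<psi>2 t \<in> R2 ((snd \<circ> x) t)" if "t \<in> {t0..t1}" for t
        using bspec[OF \<psi> that] mem[of "fst (fst (\<psi> t))" "snd (fst (\<psi> t))"
            "fst (snd (\<psi> t))" "snd (snd (\<psi> t))" t]
        by simp_all
      have cont1: "continuous_on {t0..t1} ?\<psi>1" and cont2: "continuous_on {t0..t1} ?\<psi>2"
        by (intro continuous_intros cont)+
      have "(LINT t:{t0..t1}|lebesgue. skew_pairing (?c1 t) (?\<psi>1 t)) = 0"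
        using L12 supp by (intro weakly_inD[of _ R1 _ _ "fst \<circ> x"] cont1 in1)
          (auto elim!: compact_support_in_mono simp: zero_prod_def)
      moreover have "(LINT t:{t0..t1}|lebesgue. skew_pairing (?c2 t) (?\<psi>2 t)) = 0"
        using L12 supp by (intro weakly_inD[of _ R2 _ _ "snd \<circ> x"] cont2 in2)
          (auto elim!: compact_support_in_mono simp: zero_prod_def)
      moreover have "(LINT t:{t0..t1}|lebesgue. skew_pairing (?c1 t) (?\<psi>1 t) + skew_pairing (?c2 t) (?\<psi>2 t))
        = (LINT t:{t0..t1}|lebesgue. skew_pairing (?c1 t) (?\<psi>1 t))
        + (LINT t:{t0..t1}|lebesgue. skew_pairing (?c2 t) (?\<psi>2 t))"
        unfolding o_def by (intro set_integral_add set_integrable_skew_pairing set_integrable_Pair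
            set_integrable_fst set_integrable_snd f e cont1 cont2)
      moreover have "skew_pairing (f t, e t) (\<psi> t)
          = skew_pairing (?c1 t) (?\<psi>1 t) + skew_pairing (?c2 t) (?\<psi>2 t)" for t
        by (simp add: skew_pairing_def inner_prod_def)
      ultimately show "(LINT t:{t0..t1}|lebesgue. skew_pairing (f t, e t) (\<psi> t)) = 0"
        by simp
    qed
  }
qed

section \<open>Behaviours of the interconnected system\<close>

text \<open>Settles the regularity conditions on the external port of the interconnected system in
  the classical case; \<open>set_integrable_unit\<close> does so in the weak case.\<close>

lemma continuous_on_unit: "continuous_on S (f :: 'a::topological_space \<Rightarrow> unit)"
proof -
  have "f = (\<lambda>_. ())"
    by auto
  then show ?thesis
    using continuous_on_const[of S "()"] by metis
qed

lemma set_integrable_unit: "set_integrable M S (f :: 'a \<Rightarrow> unit)"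
proof -
  have "(\<lambda>t. indicat_real S t *\<^sub>R f t) = (\<lambda>_. 0)"
    by auto
  then show ?thesis
    unfolding set_integrable_def using integrable_zero[of M] by metis
qed

context
  fixes U1 :: "(real^'n1) set" and U2 :: "(real^'n2) set"
    and J1 R1 :: "real^'n1 \<Rightarrow> real^'n1^'n1" and J2 R2 :: "real^'n2 \<Rightarrow> real^'n2^'n2"
    and B1 :: "real^'n1 \<Rightarrow> real^'m1^'n1" and B2 :: "real^'n2 \<Rightarrow> real^'m2^'n2"
    and H1 :: "real^'n1 \<Rightarrow> real" and H2 :: "real^'n2 \<Rightarrow> real"
    and A :: "(real^'n1) \<times> (real^'n2) \<Rightarrow> real^'m2^'m1"
    and t0 t1 :: real
  assumes B1: "continuous_on U1 B1" and H1: "smooth_on U1 H1"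
    and B2: "continuous_on U2 B2" and H2: "smooth_on U2 H2"
    and A: "continuous_on UNIV A"
begin

private abbreviation (input) "H \<equiv> \<lambda>(x1, x2). H1 x1 + H2 x2"

text \<open>The input matrices and Hamiltonians are controlled only on \<open>U1\<close> and
  \<open>U2\<close>, so the base curve has to stay in the product before they can be composed with
  it.\<close>

private lemma curve_facts:
  assumes "continuous_on {t0..t1} x" "x ` {t0..t1} \<subseteq> U1 \<times> U2"
  shows "continuous_on {t0..t1} (\<lambda>t. B1 (fst (x t)))" "continuous_on {t0..t1} (\<lambda>t. B2 (snd (x t)))"
    "continuous_on {t0..t1} (\<lambda>t. A (x t))"
    "continuous_on {t0..t1} (\<lambda>t. grad H1 (fst (x t)))" "continuous_on {t0..t1} (\<lambda>t. grad H2 (snd (x t)))"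
    "\<And>t. t \<in> {t0..t1} \<Longrightarrow> grad H (x t) = (grad H1 (fst (x t)), grad H2 (snd (x t)))"
proof -
  have c1: "continuous_on {t0..t1} (\<lambda>t. fst (x t))" and c2: "continuous_on {t0..t1} (\<lambda>t. snd (x t))"
    by (intro continuous_on_fst continuous_on_snd assms(1))+
  have i1: "(\<lambda>t. fst (x t)) ` {t0..t1} \<subseteq> U1" and i2: "(\<lambda>t. snd (x t)) ` {t0..t1} \<subseteq> U2"
    using assms(2) by (auto simp: image_subset_iff mem_Times_iff)
  show "continuous_on {t0..t1} (\<lambda>t. B1 (fst (x t)))" "continuous_on {t0..t1} (\<lambda>t. grad H1 (fst (x t)))"
    by (rule continuous_on_compose2[OF B1 c1 i1] continuous_on_compose2[OF continuous_on_grad[OF H1] c1 i1])+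
  show "continuous_on {t0..t1} (\<lambda>t. B2 (snd (x t)))" "continuous_on {t0..t1} (\<lambda>t. grad H2 (snd (x t)))"
    by (rule continuous_on_compose2[OF B2 c2 i2] continuous_on_compose2[OF continuous_on_grad[OF H2] c2 i2])+
  show "continuous_on {t0..t1} (\<lambda>t. A (x t))"
    by (rule continuous_on_compose2[OF A assms(1) subset_UNIV])
  show "grad H (x t) = (grad H1 (fst (x t)), grad H2 (snd (x t)))" if "t \<in> {t0..t1}" for t
    using grad_add_separate[of H1 "fst (x t)" H2 "snd (x t)"] assms(2) that
      smooth_on_imp_differentiable[OF H1] smooth_on_imp_differentiable[OF H2]
    by (simp add: image_subset_iff mem_Times_iff)
qed

private abbreviation (input) "D1 \<equiv> canonical_dirac J1 B1"
private abbreviation (input) "D2 \<equiv> canonical_dirac J2 B2"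
private abbreviation (input) "Dint \<equiv> interconnection_dirac A"

text \<open>The port variables of the subsystems are determined by the outputs \<open>y\<^sub>i = B\<^sub>i\<^sup>T \<nabla>H\<^sub>i\<close>.\<close>

private definition "port1 x t = - (transpose (B1 (fst (x t))) *v grad H1 (fst (x t)))"
private definition "port2 x t = - (transpose (B2 (snd (x t))) *v grad H2 (snd (x t)))"
private definition "input1 x t = - (A (x t) *v port2 x t)"
private definition "input2 x t = transpose (A (x t)) *v port1 x t"

private lemma ports_mem: "((port1 x t, port2 x t), (input1 x t, input2 x t)) \<in> Dint (x t)"
  by (simp add: mem_interconnection_dirac_iff input1_def input2_def)

text \<open>Continuity is the regularity required of classical ports, and on the compact interval it
  also gives the integrability required of weak ones.\<close>

private lemma continuous_on_ports:
  assumes "continuous_on {t0..t1} x" "x ` {t0..t1} \<subseteq> U1 \<times> U2"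
  shows "continuous_on {t0..t1} (port1 x)" "continuous_on {t0..t1} (port2 x)"
    "continuous_on {t0..t1} (input1 x)" "continuous_on {t0..t1} (input2 x)"
proof -
  show c: "continuous_on {t0..t1} (port1 x)" "continuous_on {t0..t1} (port2 x)"
    unfolding port1_def[abs_def] port2_def[abs_def]
    by (rule continuous_on_minus continuous_on_matrix_vector_mult continuous_on_transpose
        curve_facts[OF assms])+
  show "continuous_on {t0..t1} (input1 x)" "continuous_on {t0..t1} (input2 x)"
    unfolding input1_def[abs_def] input2_def[abs_def]
    by (rule continuous_on_minus continuous_on_matrix_vector_mult continuous_on_transpose
        c curve_facts(3)[OF assms])+
qed

text \<open>Once derivative and gradient are split into components, what remains at each time is the
  elimination of the ports from the fibre.\<close>

lemma classical_behaviour_interconnect: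
  assumes "t0 < t1"
  shows "interconnect_behaviour Dint
       (classical_behaviour U1 D1 (canonical_resistive R1) H1)
       (classical_behaviour U2 D2 (canonical_resistive R2) H2) t0 t1
     = classical_behaviour (U1 \<times> U2) (interconnect_dirac Dint D1 D2)
         (product_resistive (canonical_resistive R1) (canonical_resistive R2)) H t0 t1"
  (is "?L = ?R")
proof (rule set_eqI)
  fix c :: "((real^'n1) \<times> (real^'n2), (real^'n1) \<times> (real^'n2), unit) curve"
  obtain x f y e u where c: "c = (x, f, y, e, u)"
    by (metis prod_cases5)
  let ?d = "\<lambda>x t. vector_derivative x (at t within {t0..t1})"
  have facts: "grad H (x t) = (grad H1 (fst (x t)), grad H2 (snd (x t)))"
      "?d x t = (?d (fst \<circ> x) t, ?d (snd \<circ> x) t)"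
    if "C1_curve t0 t1 (U1 \<times> U2) x" "t \<in> {t0..t1}" for t
    using curve_facts(6)[of x t] C1_curve_imp_continuous_on[OF that(1)] C1_curve_imp_mem[OF that(1)]
      C1_curve_vector_derivative_Times[OF that(1) assms that(2)] that(2)
    by (simp_all add: image_subset_iff)
  show "c \<in> ?L \<longleftrightarrow> c \<in> ?R"
  proof
    assume "c \<in> ?L"
    then obtain \<zeta>1 \<zeta>2 u1 u2 where int: "\<forall>t\<in>{t0..t1}. ((\<zeta>1 t, \<zeta>2 t), (u1 t, u2 t)) \<in> Dint (x t)"
      and b1: "(fst \<circ> x, fst \<circ> f, (\<lambda>t. - \<zeta>1 t), fst \<circ> e, u1)
        \<in> classical_behaviour U1 D1 (canonical_resistive R1) H1 t0 t1"
      and b2: "(snd \<circ> x, snd \<circ> f, (\<lambda>t. - \<zeta>2 t), snd \<circ> e, u2)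
        \<in> classical_behaviour U2 D2 (canonical_resistive R2) H2 t0 t1"
      unfolding c interconnect_behaviour_def mem_Collect_eq case_prod_conv by blast
    have C1: "C1_curve t0 t1 (U1 \<times> U2) x"
      using b1 b2 by (simp add: classical_behaviour_def C1_curve_Times_iff)
    have "((?d x t, f t, - y t), (grad H (x t), e t, u t)) \<in> interconnect_dirac Dint D1 D2 (x t) \<and>
      (f t, e t) \<in> product_resistive (canonical_resistive R1) (canonical_resistive R2) (x t)"
      if t: "t \<in> {t0..t1}" for t
    proof -
      have "((\<zeta>1 t, \<zeta>2 t), (u1 t, u2 t)) \<in> Dint (fst (x t), snd (x t))"
        "((?d (fst \<circ> x) t, fst (f t), \<zeta>1 t), (grad H1 (fst (x t)), fst (e t), u1 t)) \<in> D1 (fst (x t))"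
        "((?d (snd \<circ> x) t, snd (f t), \<zeta>2 t), (grad H2 (snd (x t)), snd (e t), u2 t)) \<in> D2 (snd (x t))"
        "(fst (f t), fst (e t)) \<in> canonical_resistive R1 (fst (x t))"
        "(snd (f t), snd (e t)) \<in> canonical_resistive R2 (snd (x t))"
        using int b1 b2 t by (simp_all add: classical_behaviour_def)
      then have "(((?d (fst \<circ> x) t, ?d (snd \<circ> x) t), (fst (f t), snd (f t)), - y t),
          ((grad H1 (fst (x t)), grad H2 (snd (x t))), (fst (e t), snd (e t)), u t))
          \<in> interconnect_dirac Dint D1 D2 (fst (x t), snd (x t))"
        "((fst (f t), snd (f t)), (fst (e t), snd (e t)))
          \<in> product_resistive (canonical_resistive R1) (canonical_resistive R2) (fst (x t), snd (x t))"
        unfolding mem_interconnect_dirac_iff mem_product_resistive_iff by blast+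
      then show ?thesis
        by (simp add: facts[OF C1 t])
    qed
    moreover have "continuous_on {t0..t1} f" "continuous_on {t0..t1} e"
      using b1 b2 by (simp_all add: classical_behaviour_def continuous_on_prod_iff)
    ultimately show "c \<in> ?R"
      using C1 unfolding c classical_behaviour_def mem_Collect_eq case_prod_conv
      by (blast intro: continuous_on_unit)
  next
    assume "c \<in> ?R"
    then have C1: "C1_curve t0 t1 (U1 \<times> U2) x"
      and cont: "continuous_on {t0..t1} f" "continuous_on {t0..t1} e"
      and rel: "\<forall>t\<in>{t0..t1}. ((?d x t, f t, - y t), (grad H (x t), e t, u t))
          \<in> interconnect_dirac Dint D1 D2 (x t) \<and>
        (f t, e t) \<in> product_resistive (canonical_resistive R1) (canonical_resistive R2) (x t)"
      unfolding c classical_behaviour_def mem_Collect_eq case_prod_conv by blast+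
    have x: "continuous_on {t0..t1} x" "x ` {t0..t1} \<subseteq> U1 \<times> U2"
      using C1_curve_imp_continuous_on[OF C1] C1_curve_imp_mem[OF C1] by blast+
    \<comment> \<open>\<open>input1 x t\<close> equals \<open>A B2^T grad H2\<close>, so
      \<open>B1\<close> times this input is the coupling term in the first flow of the explicit
      fibre; likewise for the second subsystem.\<close>
    have "((?d (fst \<circ> x) t, fst (f t), port1 x t), (grad H1 (fst (x t)), fst (e t), input1 x t))
          \<in> D1 (fst (x t)) \<and>
        ((?d (snd \<circ> x) t, snd (f t), port2 x t), (grad H2 (snd (x t)), snd (e t), input2 x t))
          \<in> D2 (snd (x t)) \<and>
        (fst (f t), fst (e t)) \<in> canonical_resistive R1 (fst (x t)) \<and>
        (snd (f t), snd (e t)) \<in> canonical_resistive R2 (snd (x t))"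
      if t: "t \<in> {t0..t1}" for t
    proof -
      have "(((?d (fst \<circ> x) t, ?d (snd \<circ> x) t), (fst (f t), snd (f t)), - y t),
          ((grad H1 (fst (x t)), grad H2 (snd (x t))), (fst (e t), snd (e t)), u t))
          \<in> interconnect_dirac Dint D1 D2 (fst (x t), snd (x t))"
        "((fst (f t), snd (f t)), (fst (e t), snd (e t)))
          \<in> product_resistive (canonical_resistive R1) (canonical_resistive R2) (fst (x t), snd (x t))"
        using bspec[OF rel t] by (simp_all add: facts[OF C1 t])
      then show ?thesis
        unfolding mem_interconnect_canonical_dirac_iff mem_product_resistive_iff mem_canonical_dirac_iff
        by (simp add: port1_def port2_def input1_def input2_def matrix_vector_mult_uminus
            vector_matrix_mult_uminus)
    qed
    then have b: "(fst \<circ> x, fst \<circ> f, (\<lambda>t. - port1 x t), fst \<circ> e, input1 x)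
        \<in> classical_behaviour U1 D1 (canonical_resistive R1) H1 t0 t1"
      "(snd \<circ> x, snd \<circ> f, (\<lambda>t. - port2 x t), snd \<circ> e, input2 x)
        \<in> classical_behaviour U2 D2 (canonical_resistive R2) H2 t0 t1"
      using C1 cont continuous_on_ports[OF x]
      by (simp_all add: classical_behaviour_def C1_curve_Times_iff continuous_on_prod_iff[of _ f]
          continuous_on_prod_iff[of _ e] continuous_on_minus)
    show "c \<in> ?L"
      unfolding c interconnect_behaviour_def mem_Collect_eq case_prod_conv
      by (intro exI[of _ "port1 x"] exI[of _ "port2 x"] exI[of _ "input1 x"] exI[of _ "input2 x"]
          conjI ballI ports_mem b)
  qed
qed

text \<open>The weak derivative is existentially quantified inside the behaviour and is carried
  along as a witness: paired from the two subsystems in one direction, projected to them in the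
  other.\<close>

lemma weak_behaviour_interconnect:
  shows "interconnect_behaviour Dint
       (weak_behaviour U1 D1 (canonical_resistive R1) H1)
       (weak_behaviour U2 D2 (canonical_resistive R2) H2) t0 t1
     = weak_behaviour (U1 \<times> U2) (interconnect_dirac Dint D1 D2)
         (product_resistive (canonical_resistive R1) (canonical_resistive R2)) H t0 t1"
  (is "?L = ?R")
proof (rule set_eqI)
  fix c :: "((real^'n1) \<times> (real^'n2), (real^'n1) \<times> (real^'n2), unit) curve"
  obtain x f y e u where c: "c = (x, f, y, e, u)"
    by (metis prod_cases5)
  let ?w = "weakly_in_dirac (interconnect_dirac Dint D1 D2) t0 t1 x"
  \<comment> \<open>The splitting of the gradient is available only for times in the interval, so
    the two curves need not agree as functions. Weak membership sees them only under an integral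
    over that interval.\<close>
  have weak_cong: "?w (\<lambda>t. ((v t, f t, - y t), (grad H (x t), e t, u t))) \<longleftrightarrow>
      ?w (\<lambda>t. (((fst (v t), snd (v t)), (fst (f t), snd (f t)), ()),
        ((grad H1 (fst (x t)), grad H2 (snd (x t))), (fst (e t), snd (e t)), ())))"
    if x: "continuous_on {t0..t1} x" "x ` {t0..t1} \<subseteq> U1 \<times> U2" for v
  proof -
    have "(LINT t:{t0..t1}|lebesgue. sym_pairing ((v t, f t, - y t), (grad H (x t), e t, u t)) (\<psi> t))
      = (LINT t:{t0..t1}|lebesgue. sym_pairing (((fst (v t), snd (v t)), (fst (f t), snd (f t)), ()),
        ((grad H1 (fst (x t)), grad H2 (snd (x t))), (fst (e t), snd (e t)), ())) (\<psi> t))" for \<psi>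
      using curve_facts(6)[OF x] by (intro set_lebesgue_integral_cong) auto
    then show ?thesis
      unfolding weakly_in_def by simp
  qed
  have resistive: "weakly_in_lagrangian
      (product_resistive (canonical_resistive R1) (canonical_resistive R2)) t0 t1 x (\<lambda>t. (f t, e t)) \<longleftrightarrow>
    weakly_in_lagrangian (canonical_resistive R1) t0 t1 (fst \<circ> x) (\<lambda>t. ((fst \<circ> f) t, (fst \<circ> e) t)) \<and>
    weakly_in_lagrangian (canonical_resistive R2) t0 t1 (snd \<circ> x) (\<lambda>t. ((snd \<circ> f) t, (snd \<circ> e) t))"
    if "set_integrable lebesgue {t0..t1} f" "set_integrable lebesgue {t0..t1} e"
    using that by (intro weakly_in_lagrangian_product_resistive_iff)
      (simp_all add: mem_canonical_resistive_iff)
  show "c \<in> ?L \<longleftrightarrow> c \<in> ?R"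
  proof
    assume "c \<in> ?L"
    then obtain \<zeta>1 \<zeta>2 u1 u2 where int: "\<forall>t\<in>{t0..t1}. ((\<zeta>1 t, \<zeta>2 t), (u1 t, u2 t)) \<in> Dint (x t)"
      and b1: "(fst \<circ> x, fst \<circ> f, (\<lambda>t. - \<zeta>1 t), fst \<circ> e, u1)
        \<in> weak_behaviour U1 D1 (canonical_resistive R1) H1 t0 t1"
      and b2: "(snd \<circ> x, snd \<circ> f, (\<lambda>t. - \<zeta>2 t), snd \<circ> e, u2)
        \<in> weak_behaviour U2 D2 (canonical_resistive R2) H2 t0 t1"
      unfolding c interconnect_behaviour_def mem_Collect_eq case_prod_conv by blast
    from b1 obtain v1 where v1: "set_integrable lebesgue {t0..t1} v1" "weak_derivative t0 t1 (fst \<circ> x) v1"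
      "weakly_in_dirac D1 t0 t1 (fst \<circ> x)
        (\<lambda>t. ((v1 t, fst (f t), \<zeta>1 t), (grad H1 (fst (x t)), fst (e t), u1 t)))"
      by (auto simp: weak_behaviour_def)
    from b2 obtain v2 where v2: "set_integrable lebesgue {t0..t1} v2" "weak_derivative t0 t1 (snd \<circ> x) v2"
      "weakly_in_dirac D2 t0 t1 (snd \<circ> x)
        (\<lambda>t. ((v2 t, snd (f t), \<zeta>2 t), (grad H2 (snd (x t)), snd (e t), u2 t)))"
      by (auto simp: weak_behaviour_def)
    have x: "continuous_on {t0..t1} x" "x ` {t0..t1} \<subseteq> U1 \<times> U2"
      using b1 b2 by (simp_all add: weak_behaviour_def continuous_on_prod_iff[of _ x] image_subset_iff mem_Times_iff)
    have f: "set_integrable lebesgue {t0..t1} f" and e: "set_integrable lebesgue {t0..t1} e"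
      using b1 b2 by (simp_all add: weak_behaviour_def set_integrable_prod_iff[of _ _ f]
          set_integrable_prod_iff[of _ _ e])
    have \<zeta>: "set_integrable lebesgue {t0..t1} \<zeta>1" "set_integrable lebesgue {t0..t1} \<zeta>2"
      using b1 b2 by (simp_all add: weak_behaviour_def set_integrable_def)
    have u: "set_integrable lebesgue {t0..t1} u1" "set_integrable lebesgue {t0..t1} u2"
      using b1 b2 by (simp_all add: weak_behaviour_def)
    let ?v = "\<lambda>t. (v1 t, v2 t)"
    have v: "set_integrable lebesgue {t0..t1} ?v"
      by (intro set_integrable_Pair v1 v2)
    have "?w (\<lambda>t. (((v1 t, v2 t), (fst (f t), snd (f t)), ()),
        ((grad H1 (fst (x t)), grad H2 (snd (x t))), (fst (e t), snd (e t)), ())))"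
      using int by (intro weakly_in_dirac_interconnect_dirac[OF curve_facts(1-3)[OF x] _ _ _ v1(3) v2(3)]
          set_integrable_Pair v1(1) v2(1) \<zeta> u set_integrable_fst set_integrable_snd f e
          set_integrable_continuous curve_facts(4,5)[OF x]) auto
    then have "?w (\<lambda>t. ((?v t, f t, - y t), (grad H (x t), e t, u t)))"
      using weak_cong[OF x, of ?v] by simp
    moreover have "weak_derivative t0 t1 x ?v"
      using v1(2) v2(2) by (simp add: weak_derivative_prod_iff[OF x(1) v] o_def)
    moreover have "weakly_in_lagrangian
        (product_resistive (canonical_resistive R1) (canonical_resistive R2)) t0 t1 x (\<lambda>t. (f t, e t))"
      using b1 b2 by (subst resistive[OF f e]) (simp add: weak_behaviour_def)
    ultimately show "c \<in> ?R"
      using v x f e unfolding c weak_behaviour_def mem_Collect_eq case_prod_conv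
      by (blast intro: set_integrable_unit)
  next
    assume "c \<in> ?R"
    then obtain v where v: "set_integrable lebesgue {t0..t1} v" and dv: "weak_derivative t0 t1 x v"
      and w: "?w (\<lambda>t. ((v t, f t, - y t), (grad H (x t), e t, u t)))"
      and x: "continuous_on {t0..t1} x" "x ` {t0..t1} \<subseteq> U1 \<times> U2"
      and f: "set_integrable lebesgue {t0..t1} f" and e: "set_integrable lebesgue {t0..t1} e"
      and r: "weakly_in_lagrangian
        (product_resistive (canonical_resistive R1) (canonical_resistive R2)) t0 t1 x (\<lambda>t. (f t, e t))"
      unfolding c weak_behaviour_def mem_Collect_eq case_prod_conv by blast
    note ports = continuous_on_ports[OF x]
    have w': "?w (\<lambda>t. (((fst (v t), snd (v t)), (fst (f t), snd (f t)), ()),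
        ((grad H1 (fst (x t)), grad H2 (snd (x t))), (fst (e t), snd (e t)), ())))"
      using w weak_cong[OF x, of v] by simp
    \<comment> \<open>Behaviours record the output, here minus the port, and pass its negative to
      the Dirac structure; the double negation keeps the literal shape of that definition.\<close>
    have w1: "weakly_in_dirac D1 t0 t1 (fst \<circ> x)
        (\<lambda>t. (((fst \<circ> v) t, (fst \<circ> f) t, - (- port1 x t)), (grad H1 ((fst \<circ> x) t), (fst \<circ> e) t, input1 x t)))"
      and w2: "weakly_in_dirac D2 t0 t1 (snd \<circ> x)
        (\<lambda>t. (((snd \<circ> v) t, (snd \<circ> f) t, - (- port2 x t)), (grad H2 ((snd \<circ> x) t), (snd \<circ> e) t, input2 x t)))"
      using weakly_in_dirac_interconnect_diracD[where ?\<zeta>1.0 = "port1 x" and ?\<zeta>2.0 = "port2 x"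
          and ?u1.0 = "input1 x" and ?u2.0 = "input2 x" and x = x and A = A
          and ?g1.0 = "\<lambda>t. grad H1 (fst (x t))" and ?g2.0 = "\<lambda>t. grad H2 (snd (x t))"
          and ?v1.0 = "\<lambda>t. fst (v t)" and ?v2.0 = "\<lambda>t. snd (v t)"
          and ?f1.0 = "\<lambda>t. fst (f t)" and ?f2.0 = "\<lambda>t. snd (f t)"
          and ?e1.0 = "\<lambda>t. fst (e t)" and ?e2.0 = "\<lambda>t. snd (e t)",
          OF curve_facts(1-3)[OF x] w' ports_mem port1_def port2_def]
      by (simp_all add: o_def)
    have fe: "set_integrable lebesgue {t0..t1} (fst \<circ> f)" "set_integrable lebesgue {t0..t1} (snd \<circ> f)"
      "set_integrable lebesgue {t0..t1} (fst \<circ> e)" "set_integrable lebesgue {t0..t1} (snd \<circ> e)"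
      "set_integrable lebesgue {t0..t1} (fst \<circ> v)" "set_integrable lebesgue {t0..t1} (snd \<circ> v)"
      using f e v unfolding set_integrable_prod_iff[of _ _ f] set_integrable_prod_iff[of _ _ e]
        set_integrable_prod_iff[of _ _ v] by blast+
    have p: "set_integrable lebesgue {t0..t1} (\<lambda>t. - port1 x t)" "set_integrable lebesgue {t0..t1} (\<lambda>t. - port2 x t)"
      "set_integrable lebesgue {t0..t1} (input1 x)" "set_integrable lebesgue {t0..t1} (input2 x)"
      by (intro set_integrable_continuous continuous_on_minus ports)+
    have cont: "continuous_on {t0..t1} (fst \<circ> x)" "continuous_on {t0..t1} (snd \<circ> x)"
      using x(1) by (simp_all add: continuous_on_prod_iff[of _ x])
    have img: "(fst \<circ> x) ` {t0..t1} \<subseteq> U1" "(snd \<circ> x) ` {t0..t1} \<subseteq> U2"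
      using x(2) by (auto simp: image_subset_iff mem_Times_iff)
    have dv': "weak_derivative t0 t1 (fst \<circ> x) (fst \<circ> v)" "weak_derivative t0 t1 (snd \<circ> x) (snd \<circ> v)"
      using dv weak_derivative_prod_iff[OF x(1) v] by blast+
    have r': "weakly_in_lagrangian (canonical_resistive R1) t0 t1 (fst \<circ> x) (\<lambda>t. ((fst \<circ> f) t, (fst \<circ> e) t))"
      "weakly_in_lagrangian (canonical_resistive R2) t0 t1 (snd \<circ> x) (\<lambda>t. ((snd \<circ> f) t, (snd \<circ> e) t))"
      using r resistive[OF f e] by blast+
    have b1: "(fst \<circ> x, fst \<circ> f, (\<lambda>t. - port1 x t), fst \<circ> e, input1 x)
        \<in> weak_behaviour U1 D1 (canonical_resistive R1) H1 t0 t1"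
      unfolding weak_behaviour_def mem_Collect_eq case_prod_conv
      using cont(1) img(1) fe(1,3,5) p(1,3) dv'(1) w1 r'(1) by blast
    have b2: "(snd \<circ> x, snd \<circ> f, (\<lambda>t. - port2 x t), snd \<circ> e, input2 x)
        \<in> weak_behaviour U2 D2 (canonical_resistive R2) H2 t0 t1"
      unfolding weak_behaviour_def mem_Collect_eq case_prod_conv
      using cont(2) img(2) fe(2,4,6) p(2,4) dv'(2) w2 r'(2) by blast
    show "c \<in> ?L"
      unfolding c interconnect_behaviour_def mem_Collect_eq case_prod_conv
      by (intro exI[of _ "port1 x"] exI[of _ "port2 x"] exI[of _ "input1 x"] exI[of _ "input2 x"]
          conjI ballI ports_mem b1 b2)
  qed
qed

end

theorem mainTheorem4:
  fixes U1 :: "(real^'n1) set" and U2 :: "(real^'n2) set"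
    and J1 R1 :: "real^'n1 \<Rightarrow> real^'n1^'n1" and J2 R2 :: "real^'n2 \<Rightarrow> real^'n2^'n2"
    and B1 :: "real^'n1 \<Rightarrow> real^'m1^'n1" and B2 :: "real^'n2 \<Rightarrow> real^'m2^'n2"
    and H1 :: "real^'n1 \<Rightarrow> real" and H2 :: "real^'n2 \<Rightarrow> real"
    and A :: "(real^'n1) \<times> (real^'n2) \<Rightarrow> real^'m2^'m1"
    and t0 t1 :: real and \<tau> :: solution_type
  assumes "open U1" "U1 \<noteq> {}" "open U2" "U2 \<noteq> {}"
    and "smooth_on U1 J1" "smooth_on U1 R1" "smooth_on U1 B1" "smooth_on U1 H1"
    and "smooth_on U2 J2" "smooth_on U2 R2" "smooth_on U2 B2" "smooth_on U2 H2"
    and "\<And>x. x \<in> U1 \<Longrightarrow> J1 x = - transpose (J1 x)"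
    and "\<And>x. x \<in> U2 \<Longrightarrow> J2 x = - transpose (J2 x)"
    and "\<And>x. x \<in> U1 \<Longrightarrow> R1 x = transpose (R1 x) \<and> (\<forall>v. 0 \<le> v \<bullet> (R1 x *v v))"
    and "\<And>x. x \<in> U2 \<Longrightarrow> R2 x = transpose (R2 x) \<and> (\<forall>v. 0 \<le> v \<bullet> (R2 x *v v))"
    and "smooth_on UNIV A"
    and "t0 < t1"
  shows
    "interconnect_behaviour (interconnection_dirac A)
       (behaviour \<tau> U1 (canonical_dirac J1 B1) (canonical_resistive R1) H1)
       (behaviour \<tau> U2 (canonical_dirac J2 B2) (canonical_resistive R2) H2) t0 t1
     = behaviour \<tau> (U1 \<times> U2)
         (interconnect_dirac (interconnection_dirac A) (canonical_dirac J1 B1) (canonical_dirac J2 B2))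
         (product_resistive (canonical_resistive R1) (canonical_resistive R2))
         (\<lambda>(x1, x2). H1 x1 + H2 x2) t0 t1"
proof (cases \<tau>)
  case Classical
  with assms show ?thesis
    by (simp add: behaviour_def classical_behaviour_interconnect smooth_on_imp_continuous_on)
next
  case Weak
  with assms show ?thesis
    by (simp add: behaviour_def weak_behaviour_interconnect smooth_on_imp_continuous_on)
qed

end
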